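(* Let $G=B(m;R,S,T)$ be a connected bicirculant with $m\ge 3$ and $|S|\ge 3$. Assume that every connected component of the cyclic Haar graph $H(m;S)$ is hamiltonian, and, in the case $\gcd(m,S)>1$, that $R\cup T$ contains at least one element $x$ with $\gcd(x,\gcd(m,S))>1$. Then $G$ is hamiltonian.
   Context: For an integer $m\ge 1$ and subsets $R,S,T\subseteq\mathbb{Z}_m$ with $R=-R$, $T=-T$, $0\notin R\cup T$, $0\in S$ and $|R|=|T|$, the bicirculant $B(m;R,S,T)$ is the graph with vertex set $\{u_0,\dots,u_{m-1}\}\cup\{v_0,\dots,v_{m-1}\}$ and edge set $\{u_iu_{i+j}: i\in\mathbb{Z}_m, j\in R\}\cup\{v_iv_{i+j}: i\in\mathbb{Z}_m, j\in T\}\cup\{u_iv_{i+j}: i\in\mathbb{Z}_m, j\in S\}$ (indices mod $m$). The cyclic Haar graph is $H(m;S)=B(m;\emptyset,S,\emptyset)$, i.e. the spanning subgraph of the spokes. $\gcd(m,S)$ denotes the gcd of $m$ and (integer representatives of) all elements of $S$; since it divides $m$, $\gcd(x,\gcd(m,S))$ is well defined for $x\in\mathbb{Z}_m$. *)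

theory Defs
  imports Main
begin

text \<open>Simple graphs given by a vertex set V and a symmetric adjacency predicate.\<close>

definition graph_connected :: "'a set \<Rightarrow> ('a \<Rightarrow> 'a \<Rightarrow> bool) \<Rightarrow> bool" where
  "graph_connected V adj \<longleftrightarrow>
     (\<forall>x\<in>V. \<forall>y\<in>V. (\<lambda>a b. a \<in> V \<and> b \<in> V \<and> adj a b)\<^sup>*\<^sup>* x y)"

definition component_of :: "'a set \<Rightarrow> ('a \<Rightarrow> 'a \<Rightarrow> bool) \<Rightarrow> 'a \<Rightarrow> 'a set" where
  "component_of V adj x = {y \<in> V. (\<lambda>a b. a \<in> V \<and> b \<in> V \<and> adj a b)\<^sup>*\<^sup>* x y}"

definition hamiltonian :: "'a set \<Rightarrow> ('a \<Rightarrow> 'a \<Rightarrow> bool) \<Rightarrow> bool" where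
  "hamiltonian V adj \<longleftrightarrow>
     (\<exists>vs. distinct vs \<and> set vs = V \<and> length vs \<ge> 3 \<and>
        (\<forall>i < length vs. adj (vs ! i) (vs ! ((i + 1) mod length vs))))"

text \<open>Bicirculant B(m;R,S,T): vertex (False,i) is u_i, (True,i) is v_i, i in {0..<m};
  R, S, T are given by representatives in {0..<m}.\<close>
definition bic_verts :: "nat \<Rightarrow> (bool \<times> nat) set" where
  "bic_verts m = UNIV \<times> {0..<m}"

fun bic_adj :: "nat \<Rightarrow> nat set \<Rightarrow> nat set \<Rightarrow> nat set \<Rightarrow> bool \<times> nat \<Rightarrow> bool \<times> nat \<Rightarrow> bool" where
  "bic_adj m R S T (False, i) (False, k) = (\<exists>j\<in>R. k = (i + j) mod m)"
| "bic_adj m R S T (True, i) (True, k) = (\<exists>j\<in>T. k = (i + j) mod m)"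
| "bic_adj m R S T (False, i) (True, k) = (\<exists>j\<in>S. k = (i + j) mod m)"
| "bic_adj m R S T (True, k) (False, i) = (\<exists>j\<in>S. k = (i + j) mod m)"

definition haar_adj :: "nat \<Rightarrow> nat set \<Rightarrow> bool \<times> nat \<Rightarrow> bool \<times> nat \<Rightarrow> bool" where
  "haar_adj m S = bic_adj m {} S {}"

definition gcd_mS :: "nat \<Rightarrow> nat set \<Rightarrow> nat" where
  "gcd_mS m S = Gcd (insert m S)"

end

theory Submission
  imports Defs
begin

text \<open>
  Let d be the gcd of m and S. The Haar graph splits into d components, the cells; they are
  the translates of one cell, and we fix translates of one Hamilton cycle in all of them.
  If d = 1 there is nothing to do. Otherwise the elements of R (resp. T) join equal u-vertices
  (resp. v-vertices) of neighbouring cells, and connectivity says that R and T together generate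
  the integers modulo d.

  If some subset of R generates a proper nontrivial subgroup modulo d and T generates the quotient
  (or vice versa), serpentine paths in the subgroup and in the quotient arrange the cells in an
  n by k grid with n, k at least 2. There a Hamilton cycle is grown from an explicit tour of a 2 by 2
  or 3 by 3 block by repeatedly attaching a pair of adjacent cells: whichever way the tour runs
  through the two old cells, one of two local exchanges keeps it a single cycle.

  Otherwise one of R, T contains a multiple x of d while steps of the other one run through all
  cells along one line. The edges given by x are chords inside the cells; with two of them a cell
  splits into two strands, and the strands of consecutive cells are joined to a cycle. If
  2x = m, so that x lies in both R and T, the chords form a perfect matching of each side;
  either two of them do not cross, or all of them are diameters of the cycle.
\<close>

section \<open>Paths and cycles as edge sets\<close>

text \<open>The Hamilton cycle of a cell is arbitrary: it is only known to alternate between u- and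
  v-vertices and to have length 2m/d, at least 6 because S consists of at least three multiples of d
  below m. So the grid construction may refer to nothing but positions on the cycle and their
  parity. A serpentine is a path whose ends need not be adjacent. Hence the cells form a grid or a
  line without wrap-around, and each direction links one side of the bipartition only. This is why
  tours are grown by exchanges instead of going round a torus. The gcd hypothesis decides the case
  where R and T each generate the integers modulo d: an x with gcd(x, d) > 1 either generates a
  proper nontrivial subgroup, and the other set generates the quotient, or is a multiple of d and
  gives chords. The condition |R| = |T| controls m/2: a set of multiples of d cannot be just {m/2},
  and since x and m - x form pairs, m/2 lies in both sets as soon as it lies in one.\<close>

fun path_edges :: "'a list \<Rightarrow> 'a set set" where
  "path_edges [] = {}"
| "path_edges [x] = {}"
| "path_edges (x # y # zs) = insert {x, y} (path_edges (y # zs))"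

lemma path_edges_append:
  "xs \<noteq> [] \<Longrightarrow> ys \<noteq> [] \<Longrightarrow>
    path_edges (xs @ ys) = insert {last xs, hd ys} (path_edges xs \<union> path_edges ys)"
proof (induction xs rule: path_edges.induct)
  case (2 x)
  then show ?case by (cases ys) auto
qed auto

lemma path_edges_rev: "path_edges (rev xs) = path_edges xs"
proof (induction xs rule: path_edges.induct)
  case (3 x y zs)
  have "path_edges (rev (x # y # zs)) = path_edges (rev (y # zs) @ [x])" by simp
  also have "\<dots> = insert {y, x} (path_edges (rev (y # zs)))"
    by (subst path_edges_append) auto
  finally show ?case using 3 by (simp add: insert_commute)
qed auto

lemma path_edges_subset: "e \<in> path_edges xs \<Longrightarrow> e \<subseteq> set xs"
  by (induction xs rule: path_edges.induct) auto

lemma path_edges_split: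
  "e \<in> path_edges xs \<Longrightarrow> \<exists>ys zs. xs = ys @ zs \<and> ys \<noteq> [] \<and> zs \<noteq> [] \<and> e = {last ys, hd zs}"
proof (induction xs rule: path_edges.induct)
  case (3 x y zs)
  show ?case
  proof (cases "e = {x, y}")
    case True
    then show ?thesis by (intro exI[of _ "[x]"] exI[of _ "y # zs"]) auto
  next
    case False
    then obtain us vs where "y # zs = us @ vs" "us \<noteq> []" "vs \<noteq> []" "e = {last us, hd vs}"
      using 3 by auto
    then show ?thesis by (intro exI[of _ "x # us"] exI[of _ vs]) auto
  qed
qed auto

text \<open>The exact edge set is part of the predicate because an exchange has to know which edges
  survive it: later exchanges cut edges that earlier ones left alone.\<close>

definition ham_path :: "'a \<Rightarrow> 'a \<Rightarrow> 'a set \<Rightarrow> 'a set set \<Rightarrow> bool" where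
  "ham_path x y V E \<longleftrightarrow>
    (\<exists>xs. xs \<noteq> [] \<and> distinct xs \<and> hd xs = x \<and> last xs = y \<and> set xs = V \<and> path_edges xs = E)"

text \<open>The condition \<open>{y, x} \<notin> F\<close> excludes paths with two vertices, whose
  closing edge would coincide with their only edge.\<close>

definition ham_cycle :: "'a set \<Rightarrow> 'a set set \<Rightarrow> bool" where
  "ham_cycle V E \<longleftrightarrow> (\<exists>x y F. ham_path x y V F \<and> x \<noteq> y \<and> {y, x} \<notin> F \<and> E = insert {y, x} F)"

lemma ham_pathI:
  "xs \<noteq> [] \<Longrightarrow> distinct xs \<Longrightarrow> ham_path (hd xs) (last xs) (set xs) (path_edges xs)"
  unfolding ham_path_def by blast

lemma ham_path_rev: "ham_path x y V E \<Longrightarrow> ham_path y x V E"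
  unfolding ham_path_def
  by (erule exE, rule_tac x = "rev xs" in exI) (simp add: hd_rev last_rev path_edges_rev)

lemma ham_path_edges: "ham_path x y V E \<Longrightarrow> e \<in> E \<Longrightarrow> e \<subseteq> V"
  unfolding ham_path_def using path_edges_subset by blast

lemma ham_path_ends: "ham_path x y V E \<Longrightarrow> x \<in> V \<and> y \<in> V"
  unfolding ham_path_def by auto

lemma ham_path_append:
  assumes "ham_path x y V E" "ham_path z w V' E'" "V \<inter> V' = {}"
  shows "ham_path x w (V \<union> V') (insert {y, z} (E \<union> E'))"
proof -
  obtain xs where xs: "xs \<noteq> []" "distinct xs" "hd xs = x" "last xs = y" "set xs = V" "path_edges xs = E"
    using assms(1) unfolding ham_path_def by blast
  obtain ys where ys: "ys \<noteq> []" "distinct ys" "hd ys = z" "last ys = w" "set ys = V'" "path_edges ys = E'"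
    using assms(2) unfolding ham_path_def by blast
  show ?thesis unfolding ham_path_def
    by (rule exI[of _ "xs @ ys"]) (use xs ys assms(3) path_edges_append[of xs ys] in auto)
qed

lemma ham_path_split:
  assumes "ham_path x y V E" "e \<in> E"
  obtains c d V1 V2 E1 E2 where "ham_path x c V1 E1" "ham_path d y V2 E2" "V = V1 \<union> V2"
    "V1 \<inter> V2 = {}" "E = insert e (E1 \<union> E2)" "e = {c, d}"
proof -
  obtain xs where xs: "xs \<noteq> []" "distinct xs" "hd xs = x" "last xs = y" "set xs = V" "path_edges xs = E"
    using assms(1) unfolding ham_path_def by blast
  obtain ys zs where s: "xs = ys @ zs" "ys \<noteq> []" "zs \<noteq> []" "e = {last ys, hd zs}"
    using path_edges_split[of e xs] assms(2) xs(6) by blast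
  have "ham_path x (last ys) (set ys) (path_edges ys)" "ham_path (hd zs) y (set zs) (path_edges zs)"
    unfolding ham_path_def using s xs by auto
  moreover have "V = set ys \<union> set zs" "set ys \<inter> set zs = {}" using s xs by auto
  moreover have "E = insert e (path_edges ys \<union> path_edges zs)"
    using path_edges_append[of ys zs] s xs by simp
  ultimately show ?thesis using that s(4) by blast
qed

text \<open>An edge other than the closing one splits the underlying path into two pieces, and the
  closing edge joins them in the opposite order.\<close>

lemma ham_cycle_cut:
  assumes "ham_cycle V E" "{a, b} \<in> E"
  shows "ham_path a b V (E - {{a, b}})"
proof -
  obtain x y F where F: "ham_path x y V F" "x \<noteq> y" "{y, x} \<notin> F" "E = insert {y, x} F"
    using assms(1) unfolding ham_cycle_def by blast
  show ?thesis
  proof (cases "{a, b} = {y, x}")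
    case True
    then have "(a = x \<and> b = y) \<or> (a = y \<and> b = x)" by (auto simp: doubleton_eq_iff)
    moreover have "E - {{a, b}} = F" using True F by auto
    ultimately show ?thesis using F(1) ham_path_rev by metis
  next
    case False
    then have abF: "{a, b} \<in> F" using assms F by auto
    obtain c d V1 V2 E1 E2 where s: "ham_path x c V1 E1" "ham_path d y V2 E2" "V = V1 \<union> V2"
      "V1 \<inter> V2 = {}" "F = insert {a, b} (E1 \<union> E2)" "{a, b} = {c, d}"
      using ham_path_split[OF F(1) abF] by metis
    have cd: "c \<in> V1" "d \<in> V2" using ham_path_ends[OF s(1)] ham_path_ends[OF s(2)] by auto
    have "\<not> {c, d} \<subseteq> V1" "\<not> {c, d} \<subseteq> V2" using s(4) cd by auto
    then have "{a, b} \<notin> E1" "{a, b} \<notin> E2"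
      using ham_path_edges[OF s(1)] ham_path_edges[OF s(2)] unfolding s(6) by auto
    then have E: "E - {{a, b}} = insert {y, x} (E2 \<union> E1)" using s F False by auto
    have "ham_path d c (V2 \<union> V1) (insert {y, x} (E2 \<union> E1))"
      by (rule ham_path_append[OF s(2,1)]) (use s(4) in auto)
    then have "ham_path d c V (E - {{a, b}})" using E s(3) by (simp add: Un_commute)
    moreover have "(a = c \<and> b = d) \<or> (a = d \<and> b = c)" using s(6) by (auto simp: doubleton_eq_iff)
    ultimately show ?thesis using ham_path_rev by metis
  qed
qed

lemma ham_cycle_close:
  "ham_path x y V E \<Longrightarrow> x \<noteq> y \<Longrightarrow> {x, y} \<notin> E \<Longrightarrow> ham_cycle V (insert {x, y} E)"
  unfolding ham_cycle_def
  by (rule exI[of _ x], rule exI[of _ y], rule exI[of _ E]) (simp add: insert_commute)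

text \<open>Which of the two edges at y has to be cut depends on the direction in which the cycle
  traverses y relative to the edge from x' to y'.\<close>

lemma ham_cycle_separate:
  assumes c: "ham_cycle V E" and e: "{x1, y} \<in> E" "{x2, y} \<in> E" "{x', y'} \<in> E"
    and ne: "x1 \<noteq> x2" "y \<noteq> y'" "{x', y'} \<noteq> {x1, y}" "{x', y'} \<noteq> {x2, y}"
  obtains x V1 V2 E1 E2 where "x \<in> {x1, x2}" "ham_path y' x V1 E1" "ham_path y x' V2 E2"
    "V = V1 \<union> V2" "V1 \<inter> V2 = {}" "E - {{x, y}, {x', y'}} \<subseteq> E1 \<union> E2" "E1 \<union> E2 \<subseteq> E"
proof -
  have p: "ham_path y' x' V (E - {{x', y'}})"
    using ham_path_rev[OF ham_cycle_cut[OF c e(3)]] .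
  have x1E: "{x1, y} \<in> E - {{x', y'}}" using e(1) ne(3) by auto
  obtain c d V1 V2 E1 E2 where s: "ham_path y' c V1 E1" "ham_path d x' V2 E2" "V = V1 \<union> V2"
      "V1 \<inter> V2 = {}" "E - {{x', y'}} = insert {x1, y} (E1 \<union> E2)" "{x1, y} = {c, d}"
    using ham_path_split[OF p x1E] by metis
  \<comment> \<open>Without the edge from x' to y' the cycle is a path from y' to x'. The neighbour
    wanted is the predecessor of y on it. If \<open>x1\<close> turns out to be the successor, then
    the other edge at y lies in the initial piece and is the one to cut.\<close>
  consider "c = x1" "d = y" | "c = y" "d = x1" using s(6) by (auto simp: doubleton_eq_iff)
  then show ?thesis
  proof cases
    case 1
    have "E - {{x1, y}, {x', y'}} = E - {{x', y'}} - {{x1, y}}" by auto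
    also have "\<dots> \<subseteq> E1 \<union> E2" unfolding s(5) by auto
    finally have E: "E - {{x1, y}, {x', y'}} \<subseteq> E1 \<union> E2" .
    have "E1 \<union> E2 \<subseteq> E - {{x', y'}}" unfolding s(5) by (rule subset_insertI)
    then have "E1 \<union> E2 \<subseteq> E" by (rule order_trans) (rule Diff_subset)
    from that[OF _ s(1,2)[unfolded 1] s(3,4) E this] show ?thesis by simp
  next
    case 2
    have yV: "y \<in> V1" "y \<notin> V2" using ham_path_ends[OF s(1)] 2 s(4) by auto
    then have "{x2, y} \<notin> E2" using ham_path_edges[OF s(2)] by blast
    moreover have "{x2, y} \<in> E - {{x', y'}}" "{x2, y} \<noteq> {x1, y}"
      using e(2) ne(1,4) by (auto simp: doubleton_eq_iff)
    ultimately have x2E: "{x2, y} \<in> E1" unfolding s(5) by simp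
    obtain c' d' W1 W2 F1 F2 where t: "ham_path y' c' W1 F1" "ham_path d' c W2 F2" "V1 = W1 \<union> W2"
      "W1 \<inter> W2 = {}" "E1 = insert {x2, y} (F1 \<union> F2)" "{x2, y} = {c', d'}"
      using ham_path_split[OF s(1) x2E] by metis
    have "y \<in> W2" "c' \<in> W1" using ham_path_ends[OF t(1)] ham_path_ends[OF t(2)] 2 by auto
    then have "y \<noteq> c'" using t(4) by auto
    then have cd: "c' = x2" "d' = y" using t(6) by (auto simp: doubleton_eq_iff)
    have p': "ham_path y x' (W2 \<union> V2) (insert {y, x1} (F2 \<union> E2))"
      using ham_path_append[OF t(2)[unfolded cd 2] s(2)[unfolded 2]] s(4) t(3) by auto
    have "E - {{x2, y}, {x', y'}} = E - {{x', y'}} - {{x2, y}}" by auto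
    also have "\<dots> \<subseteq> F1 \<union> insert {y, x1} (F2 \<union> E2)"
      unfolding s(5) t(5) by (auto simp: insert_commute)
    finally have E: "E - {{x2, y}, {x', y'}} \<subseteq> F1 \<union> insert {y, x1} (F2 \<union> E2)" .
    have "F1 \<union> insert {y, x1} (F2 \<union> E2) \<subseteq> E - {{x', y'}}"
      unfolding s(5) t(5) by (auto simp: insert_commute)
    then have E2: "F1 \<union> insert {y, x1} (F2 \<union> E2) \<subseteq> E" by (rule order_trans) (rule Diff_subset)
    have V: "V = W1 \<union> (W2 \<union> V2)" "W1 \<inter> (W2 \<union> V2) = {}" using s(3,4) t(3,4) by auto
    from that[OF _ t(1)[unfolded cd] p' V E E2] show ?thesis by simp
  qed
qed

text \<open>The two paths of \<open>ham_cycle_separate\<close> are joined by the new edge between y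
  and y'. This leaves one path from x to x', which is closed through \<open>W\<close>: from x' to z,
  across \<open>W\<close>, and from \<open>h x\<close> back to x. The end \<open>h x\<close> and the
  edges \<open>F x\<close> depend on x because it is not known in advance which edge at y is
  cut.\<close>

lemma ham_cycle_extend:
  assumes c: "ham_cycle V E" and e: "{x1, y} \<in> E" "{x2, y} \<in> E" "{x', y'} \<in> E"
    and ne: "x1 \<noteq> x2" "y \<noteq> y'" "{x', y'} \<noteq> {x1, y}" "{x', y'} \<noteq> {x2, y}"
    and new: "\<And>x. x \<in> {x1, x2} \<Longrightarrow> ham_path z (h x) W (F x)" and disj: "V \<inter> W = {}"
  obtains x E' where "x \<in> {x1, x2}" "ham_cycle (V \<union> W) E'"
    "E - {{x, y}, {x', y'}} \<union> F x \<subseteq> E'"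
    "E' \<subseteq> E \<union> F x \<union> {{y, y'}, {x', z}, {x, h x}}"
proof -
  obtain x V1 V2 E1 E2 where s: "x \<in> {x1, x2}" "ham_path y' x V1 E1" "ham_path y x' V2 E2"
    "V = V1 \<union> V2" "V1 \<inter> V2 = {}" "E - {{x, y}, {x', y'}} \<subseteq> E1 \<union> E2" "E1 \<union> E2 \<subseteq> E"
    using ham_cycle_separate[OF c e ne] by metis
  have p1: "ham_path x x' V (insert {y', y} (E1 \<union> E2))"
    using ham_path_append[OF ham_path_rev[OF s(2)] s(3,5)] s(4) by simp
  have p2: "ham_path x (h x) (V \<union> W) (insert {x', z} (insert {y', y} (E1 \<union> E2) \<union> F x))"
    using ham_path_append[OF p1 new[OF s(1)] disj] .
  have m: "x \<in> V" "h x \<in> W" "x \<noteq> x'" "z \<in> W" "x' \<in> V"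
    using ham_path_ends[OF s(2)] ham_path_ends[OF s(3)] ham_path_ends[OF new[OF s(1)]] s(4,5) by auto
  have "\<not> {x, h x} \<subseteq> V" "\<not> {x, h x} \<subseteq> W" "{x, h x} \<noteq> {x', z}"
    using m disj by (auto simp: doubleton_eq_iff)
  then have nin: "{x, h x} \<notin> insert {x', z} (insert {y', y} (E1 \<union> E2) \<union> F x)"
    using ham_path_edges[OF p1, of "{x, h x}"] ham_path_edges[OF new[OF s(1)], of "{x, h x}"]
    by auto
  have "x \<noteq> h x" using m disj by auto
  from ham_cycle_close[OF p2 this nin]
  have cyc: "ham_cycle (V \<union> W) (insert {x, h x} (insert {x', z} (insert {y', y} (E1 \<union> E2) \<union> F x)))"
    (is "ham_cycle _ ?E'") .
  have "E1 \<union> E2 \<subseteq> ?E'" "F x \<subseteq> ?E'" by auto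
  then have "E - {{x, y}, {x', y'}} \<union> F x \<subseteq> ?E'" using s(6) by (meson Un_least order_trans)
  moreover have "?E' \<subseteq> (E1 \<union> E2) \<union> F x \<union> {{y, y'}, {x', z}, {x, h x}}"
    by (auto simp: insert_commute)
  then have "?E' \<subseteq> E \<union> F x \<union> {{y, y'}, {x', z}, {x, h x}}"
    using s(7) by (rule order_trans[OF _ Un_mono[OF Un_mono[OF _ order_refl] order_refl]])
  ultimately show ?thesis using that[OF s(1) cyc] by simp
qed

section \<open>Growing a tour of the grid of hexagons\<close>

type_synonym cell = "nat \<times> nat"

text \<open>Cells are shortened to hexagons, with the u-vertices at the even positions and the v-vertices at
  the odd ones. Tours always keep edge 5 of each hexagon, so that a longer cycle can be put in its
  place at the end.\<close>

definition cell_edge :: "cell \<Rightarrow> nat \<Rightarrow> (cell \<times> nat) set" where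
  "cell_edge c k = {(c, k), (c, Suc k mod 6)}"

definition cell_edges :: "cell \<Rightarrow> (cell \<times> nat) set set" where
  "cell_edges c = cell_edge c ` {..<6}"

text \<open>Each direction of the grid is provided by one of R and T, which links one side only;
  hence the parity conditions. The set is unbounded: the vertex set of a tour cuts out the finite
  grid.\<close>

definition grid_edges :: "(cell \<times> nat) set set" where
  "grid_edges = (\<Union>c. cell_edges c)
    \<union> {{((a, b), k), ((Suc a, b), k)} | a b k. even k \<and> k < 6}
    \<union> {{((a, b), k), ((a, Suc b), k)} | a b k. odd k \<and> k < 6}"

text \<open>The set f c lists edges of the hexagon c that the tour of D still uses and that later
  exchanges may therefore cut.\<close>

definition toured :: "cell set \<Rightarrow> (cell \<Rightarrow> nat set) \<Rightarrow> bool" where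
  "toured D f \<longleftrightarrow> (\<exists>E. ham_cycle (D \<times> {..<6}) E \<and> E \<subseteq> grid_edges \<and>
      (\<forall>c\<in>D. \<forall>k\<in>f c. cell_edge c k \<in> E))"

lemma lessThan_6: "{..<6::nat} = {0, 1, 2, 3, 4, 5}"
  by auto

lemma ham_cycle_cell: "ham_cycle ({c} \<times> {..<6}) (cell_edges c)"
proof -
  let ?xs = "[(c, 0), (c, 1), (c, 2), (c, 3), (c, 4), (c, 5::nat)]"
  have "ham_path (c, 0) (c, 5::nat) ({c} \<times> {..<6}) (path_edges ?xs)"
    unfolding ham_path_def by (rule exI[of _ ?xs]) (auto simp: lessThan_6)
  then have "ham_cycle ({c} \<times> {..<6}) (insert {(c, 0), (c, 5)} (path_edges ?xs))"
    by (rule ham_cycle_close) (auto simp: doubleton_eq_iff)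
  moreover have "cell_edges c = insert {(c, 0), (c, 5)} (path_edges ?xs)"
    unfolding cell_edges_def cell_edge_def lessThan_6
    by (simp add: insert_commute[of "(c, 5)" "(c, 0)"] insert_commute[of "{(c, 0), (c, 5)}"] flip: numeral_2_eq_2)
  ultimately show ?thesis by simp
qed

lemma cell_edge_eq_iff:
  "k < 6 \<Longrightarrow> l < 6 \<Longrightarrow> cell_edge c k = cell_edge c' l \<longleftrightarrow> c = c' \<and> k = l"
proof -
  assume "k < 6" "l < 6"
  then have "k \<in> {0, 1, 2, 3, 4, 5}" "l \<in> {0, 1, 2, 3, 4, 5}" by auto
  then show ?thesis by (elim insertE emptyE) (simp_all add: cell_edge_def doubleton_eq_iff)
qed

lemma toured_mono: "toured D f \<Longrightarrow> (\<And>c. c \<in> D \<Longrightarrow> g c \<subseteq> f c) \<Longrightarrow> toured D g"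
  unfolding toured_def by (meson subsetD)

text \<open>The vertex y is position \<open>Suc i\<close> of \<open>p\<close>, with tour edges on
  both sides, and the other edge to cut is edge \<open>j\<close> of \<open>q\<close>, which also
  ends at position \<open>Suc i\<close>. Rungs at \<open>Suc i\<close> join p to q and p' to q';
  rungs at \<open>i\<close> and \<open>i + 2\<close>, of the other parity, join old cells to new
  ones. The detour enters q', runs round it, crosses to p', runs round that and returns to p. Both
  edges at y leave the list of \<open>p\<close>, since either may have been cut. With
  \<open>i < 4\<close> edge 5 is never involved.\<close>

lemma toured_extend:
  assumes t: "toured D f" and pq: "p \<in> D" "q \<in> D" "p' \<notin> D" "q' \<notin> D" "p \<noteq> q" "p' \<noteq> q'"
    and i: "i < 4" "{i, Suc i} \<subseteq> f p" and j: "j \<in> {i, Suc i}" "j \<in> f q"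
    and f6: "\<And>c. c \<in> D \<Longrightarrow> f c \<subseteq> {..<6}"
    and g: "{(p, Suc i), (q, Suc i)} \<in> grid_edges" "{(p', Suc i), (q', Suc i)} \<in> grid_edges"
    and l: "\<And>l. l \<in> {i, i + 2} \<Longrightarrow> {(p, l), (p', l)} \<in> grid_edges"
           "\<And>l. l \<in> {i, i + 2} \<Longrightarrow> {(q, l), (q', l)} \<in> grid_edges"
  shows "toured (insert p' (insert q' D)) (f(p := f p - {i, Suc i}, q := f q - {j},
    p' := {..<6} - {i, Suc i}, q' := {..<6} - {j}))"
proof -
  obtain E where E: "ham_cycle (D \<times> {..<6}) E" "E \<subseteq> grid_edges" "\<And>c k. c \<in> D \<Longrightarrow> k \<in> f c \<Longrightarrow> cell_edge c k \<in> E"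
    using t unfolding toured_def by blast
  define m where "m = (if j = i then i else i + 2)"
  have ce: "cell_edge c i = {(c, i), (c, Suc i)}" "cell_edge c (Suc i) = {(c, i + 2), (c, Suc i)}"
    "cell_edge c j = {(c, m), (c, Suc i)}" for c
    using i(1) j(1) unfolding cell_edge_def m_def by (auto simp: insert_commute)
  have m: "m \<in> {i, i + 2}" "m < 6" unfolding m_def using i by auto
  \<comment> \<open>The index of the edge between x and position \<open>Suc i\<close>: it is cut in
    the old cell p and left out in the new cell p'.\<close>
  define e where "e x = (if snd x = i then i else Suc i)" for x :: "cell \<times> nat"
  define F where "F x = insert {(q', Suc i), (p', Suc i)}
    ((cell_edges q' - {cell_edge q' j}) \<union> (cell_edges p' - {cell_edge p' (e x)}))" for x
  have i6: "j < 6" "e x < 6" for x using i j by (auto simp: e_def)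
  have ced: "cell_edge c k \<in> cell_edges c" if "k < 6" for c k using that unfolding cell_edges_def by auto
  have new: "ham_path (q', m) (p', snd x) ({p', q'} \<times> {..<6}) (F x)"
    if x: "x \<in> {(p, i), (p, i + 2)}" for x
  proof -
    have "ham_path (q', m) (q', Suc i) ({q'} \<times> {..<6}) (cell_edges q' - {cell_edge q' j})"
      using ham_cycle_cut[OF ham_cycle_cell ced[OF i6(1), of q', unfolded ce(3)]] unfolding ce(3) .
    moreover have pe: "cell_edge p' (e x) = {(p', Suc i), (p', snd x)}"
      using x ce(1,2)[of p'] unfolding e_def by (elim insertE emptyE) (simp_all add: insert_commute)
    have "ham_path (p', Suc i) (p', snd x) ({p'} \<times> {..<6}) (cell_edges p' - {cell_edge p' (e x)})"
      using ham_cycle_cut[OF ham_cycle_cell ced[OF i6(2), of p' x, unfolded pe]] unfolding pe .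
    ultimately have "ham_path (q', m) (p', snd x) ({q'} \<times> {..<6} \<union> {p'} \<times> {..<6}) (F x)"
      unfolding F_def by (rule ham_path_append) (use pq in auto)
    moreover have "{q'} \<times> {..<6} \<union> {p'} \<times> {..<6::nat} = {p', q'} \<times> {..<6}" by auto
    ultimately show ?thesis by metis
  qed
  have ex: "e x \<in> {i, Suc i}" for x by (auto simp: e_def)
  have old: "{(p, i), (p, Suc i)} \<in> E" "{(p, i + 2), (p, Suc i)} \<in> E" "{(q, m), (q, Suc i)} \<in> E"
    using E(3)[OF pq(1), of i] E(3)[OF pq(1), of "Suc i"] E(3)[OF pq(2), of j] i(2) j(2)
    by (simp_all add: ce)
  obtain x E' where x: "x \<in> {(p, i), (p, i + 2)}" and E': "ham_cycle (D \<times> {..<6} \<union> {p', q'} \<times> {..<6}) E'"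
    "E - {{x, (p, Suc i)}, {(q, m), (q, Suc i)}} \<union> F x \<subseteq> E'"
    "E' \<subseteq> E \<union> F x \<union> {{(p, Suc i), (q, Suc i)}, {(q, m), (q', m)}, {x, (p', snd x)}}"
    by (rule ham_cycle_extend[OF E(1) old _ _ _ _ new]) (use pq in \<open>auto simp: doubleton_eq_iff\<close>)
  have xe: "{x, (p, Suc i)} = cell_edge p (e x)"
    using x ce(1,2)[of p] unfolding e_def by (elim insertE emptyE) simp_all
  have D: "D \<times> {..<6} \<union> {p', q'} \<times> {..<6} = insert p' (insert q' D) \<times> {..<6::nat}" by auto
  have cg: "cell_edges c \<subseteq> grid_edges" for c unfolding grid_edges_def by auto
  have "F x \<subseteq> grid_edges" using cg[of p'] cg[of q'] g(2) unfolding F_def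
    by (simp add: insert_commute[of "(q', Suc i)"]) (meson Diff_subset order_trans)
  moreover have "{x, (p', snd x)} \<in> grid_edges" using l(1) x by (elim insertE emptyE) simp_all
  ultimately have "E \<union> F x \<union> {{(p, Suc i), (q, Suc i)}, {(q, m), (q', m)}, {x, (p', snd x)}} \<subseteq> grid_edges"
    using E(2) g(1) l(2)[OF m(1)] by simp
  then have "E' \<subseteq> grid_edges" using E'(3) by (rule order_trans[rotated])
  moreover have "cell_edge c k \<in> E'"
    if c: "c \<in> insert p' (insert q' D)" and k: "k \<in> (f(p := f p - {i, Suc i}, q := f q - {j},
    p' := {..<6} - {i, Suc i}, q' := {..<6} - {j})) c" for c k
  proof -
    have k6: "k < 6" using c k f6[of c] pq f6[of p] f6[of q] by (auto split: if_splits)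
    consider "c = p'" | "c = q'" | "c \<in> D" "c \<noteq> p'" "c \<noteq> q'" using c by auto
    then show ?thesis
    proof cases
      case 1
      then have "cell_edge c k \<in> F x" using k pq ex[of x] ced[OF k6, of c] unfolding F_def
        by (simp add: cell_edge_eq_iff k6 i6) metis
      then show ?thesis using E'(2) by (meson UnI2 subsetD)
    next
      case 2
      then have "cell_edge c k \<in> F x" using k pq ex[of x] ced[OF k6, of c] unfolding F_def
        by (simp add: cell_edge_eq_iff k6 i6)
      then show ?thesis using E'(2) by (meson UnI2 subsetD)
    next
      case 3
      then have kf: "k \<in> f c" "c = p \<longrightarrow> k \<notin> {i, Suc i}" "c = q \<longrightarrow> k \<noteq> j"
        using k pq by (auto split: if_splits)
      then have "cell_edge c k \<in> E" using E(3) 3 by auto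
      moreover have "cell_edge c k \<noteq> cell_edge p (e x)" "cell_edge c k \<noteq> cell_edge q j"
        using kf ex[of x] k6 i6 by (auto simp: cell_edge_eq_iff)
      ultimately have "cell_edge c k \<in> E - {cell_edge p (e x), cell_edge q j} \<union> F x" by simp
      then show ?thesis using E'(2) unfolding xe ce(3)[of q] by (rule subsetD[rotated])
    qed
  qed
  ultimately show ?thesis using E'(1) unfolding toured_def D by blast
qed

lemma cell_edge_grid: "k < 6 \<Longrightarrow> cell_edge c k \<in> grid_edges"
  unfolding grid_edges_def cell_edges_def by (intro UnI1 UN_I[of c] imageI) auto

lemma grid_edge_right: "even k \<Longrightarrow> k < 6 \<Longrightarrow> {((a, b), k), ((Suc a, b), k)} \<in> grid_edges"
  unfolding grid_edges_def by (rule UnI1, rule UnI2) (rule CollectI, intro exI conjI, simp_all)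

lemma grid_edge_up: "odd k \<Longrightarrow> k < 6 \<Longrightarrow> {((a, b), k), ((a, Suc b), k)} \<in> grid_edges"
  unfolding grid_edges_def by (rule UnI2) (rule CollectI, intro exI conjI, simp_all)

section \<open>Ladders and strips of cells\<close>

definition fresh :: "(cell \<Rightarrow> nat set) \<Rightarrow> bool" where
  "fresh f \<longleftrightarrow> (\<forall>c. 5 \<in> f c \<and> f c \<subseteq> {..<6})"

lemma toured_up:
  assumes t: "toured D f" "fresh f"
    and D: "(a, b) \<in> D" "(Suc a, b) \<in> D" "(a, Suc b) \<notin> D" "(Suc a, Suc b) \<notin> D"
    and i: "odd i" "i < 4" "{i, Suc i} \<subseteq> f (a, b)" "j \<in> {i, Suc i}" "j \<in> f (Suc a, b)"
    and f': "f' = f((a, b) := f (a, b) - {i, Suc i}, (Suc a, b) := f (Suc a, b) - {j},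
      (a, Suc b) := {..<6} - {i, Suc i}, (Suc a, Suc b) := {..<6} - {j})"
  shows "toured (insert (a, Suc b) (insert (Suc a, Suc b) D)) f'" "fresh f'"
proof -
  show "toured (insert (a, Suc b) (insert (Suc a, Suc b) D)) f'"
    unfolding f' using i t(2)
    by (intro toured_extend[OF t(1) D _ _ i(2-5)])
       (auto simp: fresh_def intro!: grid_edge_right grid_edge_up)
  show "fresh f'" using i(2,4) t(2) unfolding f' fresh_def by auto
qed

lemma toured_right:
  assumes t: "toured D f" "fresh f"
    and D: "(a, b) \<in> D" "(a, Suc b) \<in> D" "(Suc a, b) \<notin> D" "(Suc a, Suc b) \<notin> D"
    and i: "even i" "i < 4" "{i, Suc i} \<subseteq> f (a, b)" "j \<in> {i, Suc i}" "j \<in> f (a, Suc b)"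
    and f': "f' = f((a, b) := f (a, b) - {i, Suc i}, (a, Suc b) := f (a, Suc b) - {j},
      (Suc a, b) := {..<6} - {i, Suc i}, (Suc a, Suc b) := {..<6} - {j})"
  shows "toured (insert (Suc a, b) (insert (Suc a, Suc b) D)) f'" "fresh f'"
proof -
  show "toured (insert (Suc a, b) (insert (Suc a, Suc b) D)) f'"
    unfolding f' using i t(2)
    by (intro toured_extend[OF t(1) D _ _ i(2-5)])
       (auto simp: fresh_def intro!: grid_edge_right grid_edge_up)
  show "fresh f'" using i(2,4) t(2) unfolding f' fresh_def by auto
qed

text \<open>Even rows spend edges 1 and 2, odd rows edges 3 and 4. A new row lacks only what its
  creation has used, so it offers the other pair. In the second column the edge to cut is always
  \<open>Suc i\<close>, that is 2 or 4, so that edges 0 and 1 stay available there for strips to the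
  right.\<close>

lemma toured_ladder:
  assumes t: "toured D f" "fresh f" and D: "(0, j) \<in> D" "(Suc 0, j) \<in> D"
    "\<And>b. b > j \<Longrightarrow> (0, b) \<notin> D \<and> (Suc 0, b) \<notin> D"
    and top: "even j \<Longrightarrow> {1, 2} \<subseteq> f (0, j) \<and> 2 \<in> f (Suc 0, j)"
      "odd j \<Longrightarrow> {3, 4} \<subseteq> f (0, j) \<and> 4 \<in> f (Suc 0, j)"
  shows "\<exists>f'. toured (D \<union> {0, Suc 0} \<times> {j<..j + k}) f' \<and> fresh f' \<and>
     (even (j + k) \<longrightarrow> {1, 2} \<subseteq> f' (0, j + k) \<and> 2 \<in> f' (Suc 0, j + k)) \<and>
     (odd (j + k) \<longrightarrow> {3, 4} \<subseteq> f' (0, j + k) \<and> 4 \<in> f' (Suc 0, j + k)) \<and>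
     (\<forall>b\<in>{j<..j + k}. {0, 1} \<subseteq> f' (Suc 0, b)) \<and>
     f (Suc 0, j) - {2, 4} \<subseteq> f' (Suc 0, j) \<and>
     (\<forall>c\<in>D - {(0, j), (Suc 0, j)}. f' c = f c)"
proof (induction k)
  case 0
  then show ?case using t top by (intro exI[of _ f]) auto
next
  case (Suc k)
  define b where "b = j + k"
  define D' where "D' = D \<union> {0, Suc 0} \<times> {j<..b}"
  obtain f' where f': "toured D' f'" "fresh f'"
     "even b \<longrightarrow> {1, 2} \<subseteq> f' (0, b) \<and> 2 \<in> f' (Suc 0, b)"
     "odd b \<longrightarrow> {3, 4} \<subseteq> f' (0, b) \<and> 4 \<in> f' (Suc 0, b)"
     "\<forall>x\<in>{j<..b}. {0, 1} \<subseteq> f' (Suc 0, x)"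
     "f (Suc 0, j) - {2, 4} \<subseteq> f' (Suc 0, j)"
     "\<forall>c\<in>D - {(0, j), (Suc 0, j)}. f' c = f c"
    using Suc.IH[folded b_def, folded D'_def] by blast
  define i :: nat where "i = (if even b then 1 else 3)"
  define h where "h = f'((0, b) := f' (0, b) - {i, Suc i}, (Suc 0, b) := f' (Suc 0, b) - {Suc i},
      (0, Suc b) := {..<6} - {i, Suc i}, (Suc 0, Suc b) := {..<6} - {Suc i})"
  have mem: "(0, b) \<in> D'" "(Suc 0, b) \<in> D'" "(0, Suc b) \<notin> D'" "(Suc 0, Suc b) \<notin> D'"
    using D unfolding D'_def b_def by (cases k; auto)+
  have i: "odd i" "i < 4" "{i, Suc i} \<subseteq> f' (0, b)" "Suc i \<in> {i, Suc i}" "Suc i \<in> f' (Suc 0, b)"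
    using f'(3,4) unfolding i_def by (auto simp flip: numeral_2_eq_2)
  have "toured (insert (0, Suc b) (insert (Suc 0, Suc b) D')) h" and fr: "fresh h"
    using toured_up[OF f'(1,2) mem i h_def] by auto
  moreover have "insert (0, Suc b) (insert (Suc 0, Suc b) D') = D \<union> {0, Suc 0} \<times> {j<..j + Suc k}"
    unfolding D'_def b_def by (auto simp: less_Suc_eq_le le_Suc_eq)
  ultimately have "toured (D \<union> {0, Suc 0} \<times> {j<..j + Suc k}) h" by simp
  moreover have "(even (j + Suc k) \<longrightarrow> {1, 2} \<subseteq> h (0, j + Suc k) \<and> 2 \<in> h (Suc 0, j + Suc k))"
    "(odd (j + Suc k) \<longrightarrow> {3, 4} \<subseteq> h (0, j + Suc k) \<and> 4 \<in> h (Suc 0, j + Suc k))"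
    unfolding h_def b_def i_def by auto
  moreover have "\<forall>x\<in>{j<..j + Suc k}. {0, 1} \<subseteq> h (Suc 0, x)"
    using f'(5) unfolding h_def b_def i_def by (auto simp: le_Suc_eq)
  moreover have "f (Suc 0, j) - {2, 4} \<subseteq> h (Suc 0, j)"
    using f'(6) unfolding h_def b_def i_def by auto
  moreover have "\<forall>c\<in>D - {(0, j), (Suc 0, j)}. h c = f c"
    using f'(7) D(3) unfolding h_def b_def by (auto split: if_splits)
  ultimately show ?case using fr by blast
qed

text \<open>The exchanges alternate between edges 0, 1 and edges 2, 3, so that the last column always offers
  fresh edges.\<close>

lemma toured_strip:
  assumes t: "toured D f" "fresh f" and D: "(s, b) \<in> D" "(s, Suc b) \<in> D"
    "\<And>a. a > s \<Longrightarrow> (a, b) \<notin> D \<and> (a, Suc b) \<notin> D"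
    and top: "{0, 1} \<subseteq> f (s, b)" "0 \<in> f (s, Suc b)"
  shows "\<exists>f'. toured (D \<union> {s<..s + k} \<times> {b, Suc b}) f' \<and> fresh f' \<and>
     (even k \<longrightarrow> {0, 1} \<subseteq> f' (s + k, b) \<and> 0 \<in> f' (s + k, Suc b)) \<and>
     (odd k \<longrightarrow> {2, 3} \<subseteq> f' (s + k, b) \<and> 3 \<in> f' (s + k, Suc b)) \<and>
     (\<forall>c\<in>D - {(s, b), (s, Suc b)}. f' c = f c)"
proof (induction k)
  case 0
  then show ?case using t top by (intro exI[of _ f]) auto
next
  case (Suc k)
  define a where "a = s + k"
  define D' where "D' = D \<union> {s<..a} \<times> {b, Suc b}"
  obtain f' where f': "toured D' f'" "fresh f'"
     "even k \<longrightarrow> {0, 1} \<subseteq> f' (a, b) \<and> 0 \<in> f' (a, Suc b)"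
     "odd k \<longrightarrow> {2, 3} \<subseteq> f' (a, b) \<and> 3 \<in> f' (a, Suc b)"
     "\<forall>c\<in>D - {(s, b), (s, Suc b)}. f' c = f c"
    using Suc.IH[folded a_def, folded D'_def] by blast
  define i :: nat where "i = (if even k then 0 else 2)"
  define j :: nat where "j = (if even k then 0 else 3)"
  define h where "h = f'((a, b) := f' (a, b) - {i, Suc i}, (a, Suc b) := f' (a, Suc b) - {j},
      (Suc a, b) := {..<6} - {i, Suc i}, (Suc a, Suc b) := {..<6} - {j})"
  have mem: "(a, b) \<in> D'" "(a, Suc b) \<in> D'" "(Suc a, b) \<notin> D'" "(Suc a, Suc b) \<notin> D'"
    using D unfolding D'_def a_def by (cases k; auto)+
  have i: "even i" "i < 4" "{i, Suc i} \<subseteq> f' (a, b)" "j \<in> {i, Suc i}" "j \<in> f' (a, Suc b)"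
    using f'(3,4) unfolding i_def j_def by auto
  have "toured (insert (Suc a, b) (insert (Suc a, Suc b) D')) h" and fr: "fresh h"
    using toured_right[OF f'(1,2) mem i h_def] by auto
  moreover have "insert (Suc a, b) (insert (Suc a, Suc b) D') = D \<union> {s<..s + Suc k} \<times> {b, Suc b}"
    unfolding D'_def a_def by (auto simp: less_Suc_eq_le le_Suc_eq)
  ultimately have "toured (D \<union> {s<..s + Suc k} \<times> {b, Suc b}) h" by simp
  moreover have "(even (Suc k) \<longrightarrow> {0, 1} \<subseteq> h (s + Suc k, b) \<and> 0 \<in> h (s + Suc k, Suc b))"
    "(odd (Suc k) \<longrightarrow> {2, 3} \<subseteq> h (s + Suc k, b) \<and> 3 \<in> h (s + Suc k, Suc b))"
    unfolding h_def a_def i_def j_def by auto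
  moreover have "\<forall>c\<in>D - {(s, b), (s, Suc b)}. h c = f c"
    using f'(5) D(3) unfolding h_def a_def by (auto split: if_splits)
  ultimately show ?case using fr by blast
qed

text \<open>Pairs of rows are independent, since a strip changes \<open>f\<close> only within its
  own two rows. The last clause records this for the rows outside the range.\<close>

lemma toured_strips:
  assumes t: "toured D f" "fresh f"
    and D: "\<And>b. b \<in> {r..<r + 2 * k} \<Longrightarrow> (Suc 0, b) \<in> D \<and> {0, 1} \<subseteq> f (Suc 0, b)"
      "\<And>a b. b \<in> {r..<r + 2 * k} \<Longrightarrow> a > Suc 0 \<Longrightarrow> (a, b) \<notin> D" and n: "n \<ge> 2"
  shows "\<exists>f'. toured (D \<union> {Suc 0<..<n} \<times> {r..<r + 2 * k}) f' \<and> fresh f' \<and>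
     (\<forall>c\<in>D. snd c \<notin> {r..<r + 2 * k} \<longrightarrow> f' c = f c)"
  using D
proof (induction k)
  case 0
  then show ?case using t by (intro exI[of _ f]) auto
next
  case (Suc k)
  define D' where "D' = D \<union> {Suc 0<..<n} \<times> {r..<r + 2 * k}"
  obtain f' where f': "toured D' f'" "fresh f'"
     "\<And>c. c \<in> D \<Longrightarrow> snd c \<notin> {r..<r + 2 * k} \<Longrightarrow> f' c = f c"
    using Suc.IH Suc.prems unfolding D'_def by auto
  define b where "b = r + 2 * k"
  have b: "(Suc 0, b) \<in> D" "(Suc 0, Suc b) \<in> D" "{0, 1} \<subseteq> f (Suc 0, b)" "{0, 1} \<subseteq> f (Suc 0, Suc b)"
    using Suc.prems(1)[of b] Suc.prems(1)[of "Suc b"] unfolding b_def by auto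
  have "f' (Suc 0, b) = f (Suc 0, b)" "f' (Suc 0, Suc b) = f (Suc 0, Suc b)"
    by (rule f'(3); use b in \<open>simp add: b_def\<close>)+
  then have "{0, 1} \<subseteq> f' (Suc 0, b)" "0 \<in> f' (Suc 0, Suc b)" using b by auto
  moreover have "(Suc 0, b) \<in> D'" "(Suc 0, Suc b) \<in> D'" using b unfolding D'_def by auto
  moreover have "(a, b) \<notin> D' \<and> (a, Suc b) \<notin> D'" if "a > Suc 0" for a
    using Suc.prems(2)[OF _ that] unfolding D'_def b_def by auto
  ultimately obtain h where h: "toured (D' \<union> {Suc 0<..Suc 0 + (n - 2)} \<times> {b, Suc b}) h" "fresh h"
     "\<forall>c\<in>D' - {(Suc 0, b), (Suc 0, Suc b)}. h c = f' c"
    using toured_strip[OF f'(1,2), of "Suc 0" b "n - 2"] by blast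
  have "D' \<union> {Suc 0<..Suc 0 + (n - 2)} \<times> {b, Suc b} = D \<union> {Suc 0<..<n} \<times> {r..<r + 2 * Suc k}"
    using n unfolding D'_def b_def by auto
  moreover have "h c = f c" if "c \<in> D" "snd c \<notin> {r..<r + 2 * Suc k}" for c
  proof -
    have "c \<in> D' - {(Suc 0, b), (Suc 0, Suc b)}" using that unfolding D'_def b_def by auto
    then show ?thesis using h(3) f'(3)[OF that(1)] that(2) by auto
  qed
  ultimately show ?case using h(1,2) by auto
qed

text \<open>This serves an odd number of rows, where three are left after pairing. Columns are added
  two at a time: two exchanges to the right fill rows 0 and 1, and an upward exchange from the two
  new cells of row 1 fills row 2.\<close>

lemma toured_triple_strip:
  assumes t: "toured D f" "fresh f" and D: "(s, 0) \<in> D" "(s, Suc 0) \<in> D"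
    "\<And>a b. a > s \<Longrightarrow> b < 3 \<Longrightarrow> (a, b) \<notin> D"
    and top: "{0, 1} \<subseteq> f (s, 0)" "0 \<in> f (s, Suc 0)"
  shows "\<exists>f'. toured (D \<union> {s<..s + 2 * k} \<times> {..<3}) f' \<and> fresh f' \<and>
     {0, 1} \<subseteq> f' (s + 2 * k, 0) \<and> 0 \<in> f' (s + 2 * k, Suc 0)"
proof (induction k)
  case 0
  then show ?case using t top by (intro exI[of _ f]) auto
next
  case (Suc k)
  define a where "a = s + 2 * k"
  define D1 where "D1 = D \<union> {s<..a} \<times> {..<3}"
  obtain f1 where f1: "toured D1 f1" "fresh f1" "{0, 1} \<subseteq> f1 (a, 0)" "0 \<in> f1 (a, Suc 0)"
    using Suc.IH[folded a_def, folded D1_def] by blast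
  have m1: "(a, 0) \<in> D1" "(a, Suc 0) \<in> D1" using D unfolding D1_def a_def by (cases k; auto)+
  have n1: "(x, b) \<notin> D1" if "x > a" "b < 3" for x b
    using that D(3)[of x b] unfolding D1_def a_def by auto
  define f2 where "f2 = f1((a, 0) := f1 (a, 0) - {0, Suc 0}, (a, Suc 0) := f1 (a, Suc 0) - {0},
      (Suc a, 0) := {..<6} - {0, Suc 0}, (Suc a, Suc 0) := {..<6} - {0})"
  define D2 where "D2 = insert (Suc a, 0) (insert (Suc a, Suc 0) D1)"
  have c1: "even (0::nat)" "0 < (4::nat)" "{0, Suc 0} \<subseteq> f1 (a, 0)" "0 \<in> {0, Suc 0}" "0 \<in> f1 (a, Suc 0)"
    using f1(3,4) by auto
  have f2: "toured D2 f2" "fresh f2"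
    using toured_right[OF f1(1,2) m1 n1 n1 c1 f2_def] unfolding D2_def by auto
  \<comment> \<open>In row 1 edge 3 is cut and not edge 2, because the upward exchange still needs
    edges 1 and 2 of \<open>(Suc a, Suc 0)\<close>.\<close>
  define f3 where "f3 = f2((Suc a, 0) := f2 (Suc a, 0) - {2, Suc 2}, (Suc a, Suc 0) := f2 (Suc a, Suc 0) - {3},
      (Suc (Suc a), 0) := {..<6} - {2, Suc 2}, (Suc (Suc a), Suc 0) := {..<6} - {3})"
  define D3 where "D3 = insert (Suc (Suc a), 0) (insert (Suc (Suc a), Suc 0) D2)"
  have m2: "(Suc a, 0) \<in> D2" "(Suc a, Suc 0) \<in> D2"
    "(Suc (Suc a), 0) \<notin> D2" "(Suc (Suc a), Suc 0) \<notin> D2"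
    using n1 unfolding D2_def by auto
  have c2: "even (2::nat)" "2 < (4::nat)" "{2, Suc 2} \<subseteq> f2 (Suc a, 0)" "3 \<in> {2, Suc 2}" "3 \<in> f2 (Suc a, Suc 0)"
    unfolding f2_def by auto
  have f3: "toured D3 f3" "fresh f3"
    using toured_right[OF f2 m2 c2 f3_def] unfolding D3_def by auto
  define f4 where "f4 = f3((Suc a, Suc 0) := f3 (Suc a, Suc 0) - {1, Suc 1},
      (Suc (Suc a), Suc 0) := f3 (Suc (Suc a), Suc 0) - {2},
      (Suc a, Suc (Suc 0)) := {..<6} - {1, Suc 1}, (Suc (Suc a), Suc (Suc 0)) := {..<6} - {2})"
  define D4 where "D4 = insert (Suc a, Suc (Suc 0)) (insert (Suc (Suc a), Suc (Suc 0)) D3)"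
  have m3: "(Suc a, Suc 0) \<in> D3" "(Suc (Suc a), Suc 0) \<in> D3"
    "(Suc a, Suc (Suc 0)) \<notin> D3" "(Suc (Suc a), Suc (Suc 0)) \<notin> D3"
    using n1 unfolding D3_def D2_def by auto
  have c3: "odd (1::nat)" "1 < (4::nat)" "{1, Suc 1} \<subseteq> f3 (Suc a, Suc 0)" "2 \<in> {1, Suc 1}"
    "2 \<in> f3 (Suc (Suc a), Suc 0)"
    unfolding f3_def f2_def by auto
  have f4: "toured D4 f4" "fresh f4"
    using toured_up[OF f3 m3 c3 f4_def] unfolding D4_def by auto
  have "D4 = D \<union> {s<..s + 2 * Suc k} \<times> {..<3}"
    unfolding D4_def D3_def D2_def D1_def a_def by (auto simp: numeral_3_eq_3 less_Suc_eq)
  moreover have "s + 2 * Suc k = Suc (Suc a)" unfolding a_def by simp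
  moreover have "{0, 1} \<subseteq> f4 (Suc (Suc a), 0)" "0 \<in> f4 (Suc (Suc a), Suc 0)"
    unfolding f4_def f3_def by auto
  ultimately show ?case using f4 by metis
qed

section \<open>Explicit seed tours\<close>

text \<open>A form of the edge relation that rewriting evaluates on explicit vertices, so that the
  seed tours can be checked by simplification.\<close>

fun grid_adj :: "cell \<times> nat \<Rightarrow> cell \<times> nat \<Rightarrow> bool" where
  "grid_adj ((a, b), k) ((a', b'), k') \<longleftrightarrow>
     (if a = a' \<and> b = b' then (k' = Suc k mod 6 \<or> k = Suc k' mod 6)
      else k = k' \<and> (if even k then b = b' \<and> (a' = Suc a \<or> a = Suc a')
                            else a = a' \<and> (b' = Suc b \<or> b = Suc b')))"

lemma grid_adj_edge:
  assumes "grid_adj x y" "snd x < 6" "snd y < 6"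
  shows "{x, y} \<in> grid_edges"
proof -
  obtain a b k a' b' k' where xy: "x = ((a, b), k)" "y = ((a', b'), k')" by (metis surj_pair)
  have k: "k < 6" "k' < 6" using assms(2,3) xy by auto
  consider "a = a'" "b = b'" "k' = Suc k mod 6" | "a = a'" "b = b'" "k = Suc k' mod 6"
    | "k = k'" "even k" "b = b'" "a' = Suc a" | "k = k'" "even k" "b = b'" "a = Suc a'"
    | "k = k'" "odd k" "a = a'" "b' = Suc b" | "k = k'" "odd k" "a = a'" "b = Suc b'"
    using assms(1) unfolding xy grid_adj.simps by metis
  then show ?thesis
  proof cases
    case 1
    then have "{x, y} = cell_edge (a, b) k" unfolding xy cell_edge_def by simp
    then show ?thesis using cell_edge_grid k by simp
  next
    case 2
    then have "{x, y} = cell_edge (a, b) k'" unfolding xy cell_edge_def by (simp add: insert_commute)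
    then show ?thesis using cell_edge_grid k by simp
  next
    case 3
    then show ?thesis using grid_edge_right[of k a b] k unfolding xy by simp
  next
    case 4
    then show ?thesis using grid_edge_right[of k a' b] k unfolding xy by (simp add: insert_commute)
  next
    case 5
    then show ?thesis using grid_edge_up[of k a b] k unfolding xy by simp
  next
    case 6
    then show ?thesis using grid_edge_up[of k a b'] k unfolding xy by (simp add: insert_commute)
  qed
qed

lemma path_edges_grid:
  "successively grid_adj xs \<Longrightarrow> \<forall>x\<in>set xs. snd x < 6 \<Longrightarrow> path_edges xs \<subseteq> grid_edges"
  by (induction xs rule: path_edges.induct) (use grid_adj_edge in auto)

lemma path_edges_hd_last:
  assumes "distinct xs" "length xs > 2"
  shows "{hd xs, last xs} \<notin> path_edges xs"
proof
  assume "{hd xs, last xs} \<in> path_edges xs"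
  then obtain ys zs where s: "xs = ys @ zs" "ys \<noteq> []" "zs \<noteq> []" "{hd xs, last xs} = {last ys, hd zs}"
    using path_edges_split by metis
  have "hd xs \<in> set ys" "last xs \<in> set zs" "last ys \<in> set ys" "hd zs \<in> set zs" using s by auto
  then have "hd xs \<noteq> hd zs" using s(1) assms(1) by auto
  then have hl: "hd ys = last ys" "last zs = hd zs"
    using s by (auto simp: doubleton_eq_iff)
  have "ys = [hd ys]" using hl(1) s(1,2) assms(1) by (cases ys) (auto split: if_splits)
  moreover have "zs = [hd zs]" using hl(2) s(1,3) assms(1) by (cases zs) (auto split: if_splits)
  ultimately have "length xs = 2" using s(1) by (metis length_append length_Cons list.size(3) one_add_one One_nat_def)
  then show False using assms(2) by simp
qed

text \<open>As many distinct vertices as \<open>D \<times> {..<6}\<close> has must be all of them,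
  so a tour needs no check of coverage beyond its length.\<close>

lemma toured_list:
  assumes "distinct xs" "length xs > 2" "\<forall>x\<in>set xs. fst x \<in> D \<and> snd x < 6"
    "successively grid_adj xs" "grid_adj (last xs) (hd xs)" "finite D" "length xs = 6 * card D"
    "\<And>c k. c \<in> D \<Longrightarrow> k \<in> f c \<Longrightarrow> cell_edge c k \<in> insert {hd xs, last xs} (path_edges xs)"
  shows "toured D f"
proof -
  have ne: "xs \<noteq> []" using assms(2) by auto
  have set: "set xs = D \<times> {..<6}"
  proof (rule card_subset_eq)
    show "card (set xs) = card (D \<times> {..<6::nat})"
      using assms(7) distinct_card[OF assms(1)] by (simp add: card_cartesian_product)
  qed (use assms(3,6) in auto)
  have "hd xs \<noteq> last xs" using assms(1,2) by (cases xs; cases "tl xs") auto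
  then have "ham_cycle (D \<times> {..<6}) (insert {hd xs, last xs} (path_edges xs))"
    using ham_cycle_close[OF ham_pathI[OF ne assms(1)] _ path_edges_hd_last[OF assms(1,2)]] set by simp
  then have c: "ham_cycle (D \<times> {..<6}) (insert {hd xs, last xs} (path_edges xs))" .
  have s6: "\<forall>x\<in>set xs. snd x < 6" using set by auto
  have "path_edges xs \<subseteq> grid_edges" by (rule path_edges_grid[OF assms(4) s6])
  moreover have "{hd xs, last xs} \<in> grid_edges"
    using grid_adj_edge[OF assms(5)] s6 ne by (simp add: insert_commute)
  ultimately have "insert {hd xs, last xs} (path_edges xs) \<subseteq> grid_edges" by simp
  then show ?thesis using assms(8) c unfolding toured_def by metis
qed

text \<open>The two tours were found by computer search.\<close>

definition tour_2x2 :: "(cell \<times> nat) list" where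
  "tour_2x2 = [((0, 0), 5), ((0, 0), 0), ((0, 0), 1), ((0, 0), 2), ((1, 0), 2), ((1, 0), 1),
    ((1, 0), 0), ((1, 0), 5), ((1, 0), 4), ((1, 0), 3), ((1, 1), 3), ((1, 1), 4),
    ((1, 1), 5), ((1, 1), 0), ((1, 1), 1), ((1, 1), 2), ((0, 1), 2), ((0, 1), 1),
    ((0, 1), 0), ((0, 1), 5), ((0, 1), 4), ((0, 1), 3), ((0, 0), 3), ((0, 0), 4)]"

definition tour_3x3 :: "(cell \<times> nat) list" where
  "tour_3x3 = [((0, 0), 5), ((0, 0), 0), ((0, 0), 1), ((0, 0), 2), ((0, 0), 3), ((0, 0), 4),
    ((1, 0), 4), ((2, 0), 4), ((2, 0), 5), ((2, 0), 0), ((2, 0), 1), ((2, 0), 2),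
    ((2, 0), 3), ((2, 1), 3), ((2, 2), 3), ((2, 2), 2), ((2, 2), 1), ((2, 2), 0),
    ((2, 2), 5), ((2, 2), 4), ((1, 2), 4), ((1, 2), 5), ((1, 2), 0), ((0, 2), 0),
    ((0, 2), 5), ((0, 2), 4), ((0, 2), 3), ((0, 2), 2), ((0, 2), 1), ((0, 1), 1),
    ((0, 1), 2), ((0, 1), 3), ((0, 1), 4), ((1, 1), 4), ((2, 1), 4), ((2, 1), 5),
    ((2, 1), 0), ((2, 1), 1), ((2, 1), 2), ((1, 1), 2), ((1, 1), 1), ((1, 2), 1),
    ((1, 2), 2), ((1, 2), 3), ((1, 1), 3), ((1, 0), 3), ((1, 0), 2), ((1, 0), 1),
    ((1, 0), 0), ((1, 0), 5), ((1, 1), 5), ((1, 1), 0), ((0, 1), 0), ((0, 1), 5)]"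

text \<open>Besides edge 5 this lists what later growth asks for: edges 3, 4 of
  \<open>(0, 1)\<close> and 4 of \<open>(1, 1)\<close> start a ladder from row 1, and edges 0, 1 in
  column 1 start strips.\<close>

definition fresh_2x2 :: "cell \<Rightarrow> nat set" where
  "fresh_2x2 c = (if c = (1, 0) then {0, 1, 5} else if c = (0, 1) then {3, 4, 5}
     else if c = (1, 1) then {0, 1, 4, 5} else {5})"

text \<open>Edges 1, 2 of \<open>(0, 2)\<close> and 2 of \<open>(1, 2)\<close> start a ladder from
  row 2; edges 0, 1 of \<open>(2, 0)\<close> and 0 of \<open>(2, 1)\<close> start a triple strip
  from column 2.\<close>

definition fresh_3x3 :: "cell \<Rightarrow> nat set" where
  "fresh_3x3 c = (if c = (0, 2) then {1, 2, 5} else if c = (1, 2) then {2, 5}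
     else if c = (2, 0) then {0, 1, 5} else if c = (2, 1) then {0, 5} else {5})"

lemma toured_2x2: "toured ({0, 1} \<times> {0, 1}) fresh_2x2"
proof (rule toured_list[where xs = tour_2x2])
  fix c :: cell and k
  assume "c \<in> {0, 1} \<times> {0, 1}" "k \<in> fresh_2x2 c"
  then have "(c, k) \<in> {((0, 0), 5), ((1, 0), 0), ((1, 0), 1), ((1, 0), 5), ((0, 1), 3), ((0, 1), 4), ((0, 1), 5), ((1, 1), 0), ((1, 1), 1), ((1, 1), 4), ((1, 1), 5)}"
    unfolding fresh_2x2_def by (cases c) (elim SigmaE insertE emptyE; simp; blast)
  then show "cell_edge c k \<in> insert {hd tour_2x2, last tour_2x2} (path_edges tour_2x2)"
    unfolding tour_2x2_def
    by (elim insertE emptyE) (simp_all add: cell_edge_def doubleton_eq_iff)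
qed (simp_all add: tour_2x2_def card_cartesian_product)

lemma toured_3x3: "toured ({0, 1, 2} \<times> {0, 1, 2}) fresh_3x3"
proof (rule toured_list[where xs = tour_3x3])
  fix c :: cell and k
  assume "c \<in> {0, 1, 2} \<times> {0, 1, 2}" "k \<in> fresh_3x3 c"
  then have "(c, k) \<in> {((0, 0), 5), ((0, 1), 5), ((1, 0), 5), ((1, 1), 5), ((2, 2), 5), ((0, 2), 1), ((0, 2), 2), ((0, 2), 5), ((1, 2), 2), ((1, 2), 5), ((2, 0), 0), ((2, 0), 1), ((2, 0), 5), ((2, 1), 0), ((2, 1), 5)}"
    unfolding fresh_3x3_def by (cases c) (elim SigmaE insertE emptyE; simp; blast)
  then show "cell_edge c k \<in> insert {hd tour_3x3, last tour_3x3} (path_edges tour_3x3)"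
    unfolding tour_3x3_def
    by (elim insertE emptyE) (simp_all add: cell_edge_def doubleton_eq_iff)
qed (simp_all add: tour_3x3_def card_cartesian_product)

section \<open>Tours of all grids\<close>

lemma toured_two_columns:
  assumes "g \<ge> 2"
  shows "\<exists>f. toured ({0, Suc 0} \<times> {..<g}) f \<and> fresh f \<and> (\<forall>b<g. {0, 1} \<subseteq> f (Suc 0, b))"
proof -
  have fr: "fresh fresh_2x2" unfolding fresh_def fresh_2x2_def by auto
  define k where "k = g - 2"
  have g: "g = k + 2" using assms unfolding k_def by simp
  have b: "(0, 1) \<in> {0, 1} \<times> {0, 1::nat}" "(Suc 0, 1) \<in> {0, 1} \<times> {0, 1::nat}"
    "\<And>b. b > 1 \<Longrightarrow> (0, b) \<notin> {0, 1} \<times> {0, 1::nat} \<and> (Suc 0, b) \<notin> {0, 1} \<times> {0, 1::nat}"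
    "even (1::nat) \<Longrightarrow> {1, 2} \<subseteq> fresh_2x2 (0, 1) \<and> 2 \<in> fresh_2x2 (Suc 0, 1)"
    "odd (1::nat) \<Longrightarrow> {3, 4} \<subseteq> fresh_2x2 (0, 1) \<and> 4 \<in> fresh_2x2 (Suc 0, 1)"
    by (auto simp: fresh_2x2_def)
  obtain f where f: "toured ({0, 1} \<times> {0, 1} \<union> {0, Suc 0} \<times> {1<..1 + k}) f" "fresh f"
    "\<forall>b\<in>{1<..1 + k}. {0, 1} \<subseteq> f (Suc 0, b)"
    "fresh_2x2 (Suc 0, 1) - {2, 4} \<subseteq> f (Suc 0, 1)"
    "\<forall>c\<in>{0, 1} \<times> {0, 1} - {(0, 1), (Suc 0, 1)}. f c = fresh_2x2 c"
    using toured_ladder[OF toured_2x2 fr b, of k] by metis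
  have "{0, 1} \<times> {0, 1} \<union> {0, Suc 0} \<times> {1<..1 + k} = {0, Suc 0} \<times> {..<g}"
    unfolding g by (auto simp: less_Suc_eq_le)
  moreover have "{0, 1} \<subseteq> f (Suc 0, b)" if "b < g" for b
  proof -
    consider "b = 0" | "b = 1" | "b \<in> {1<..1 + k}" using \<open>b < g\<close> unfolding g by force
    then show ?thesis
    proof cases
      case 1
      have "f (Suc 0, 0) = fresh_2x2 (Suc 0, 0)" by (rule bspec[OF f(5)]) auto
      then show ?thesis using 1 by (simp add: fresh_2x2_def)
    next
      case 2
      have "{0, 1} \<subseteq> fresh_2x2 (Suc 0, 1) - {2, 4}" by (simp add: fresh_2x2_def)
      then show ?thesis using f(4) 2 by (meson order_trans)
    next
      case 3
      then show ?thesis using f(3) by blast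
    qed
  qed
  ultimately show ?thesis using f(1,2) by auto
qed

text \<open>Every exchange adds two cells, so the number of cells keeps the parity of the seed: 2 by
  2 serves when \<open>n\<close> or \<open>g\<close> is even, 3 by 3 when both are odd. For even
  \<open>g\<close> strips over pairs of rows suffice. For odd \<open>g\<close> the rows from 3 on
  are paired, and triple strips finish the bottom three rows.\<close>

theorem toured_grid:
  assumes "n \<ge> 2" "g \<ge> 2"
  shows "toured ({..<n} \<times> {..<g}) (\<lambda>_. {5})"
proof -
  have weaken: "toured ({..<n} \<times> {..<g}) (\<lambda>_. {5})"
    if "toured D f" "fresh f" "D = {..<n} \<times> {..<g}" for D f
    using toured_mono[OF that(1), of "\<lambda>_. {5}"] that(2,3) unfolding fresh_def by simp
  obtain f where f: "toured ({0, Suc 0} \<times> {..<g}) f" "fresh f" "\<And>b. b < g \<Longrightarrow> {0, 1} \<subseteq> f (Suc 0, b)"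
    using toured_two_columns[OF assms(2)] by blast
  consider "even g" | "odd g" "even n" | "odd g" "odd n" by blast
  then show ?thesis
  proof cases
    case 1
    then obtain k where k: "g = 2 * k" by (elim evenE)
    obtain f' where f': "toured ({0, Suc 0} \<times> {..<g} \<union> {Suc 0<..<n} \<times> {0..<0 + 2 * k}) f'" "fresh f'"
      using toured_strips[OF f(1,2), of 0 k n] f(3) assms unfolding k by auto
    show ?thesis by (rule weaken[OF f']) (use assms k in auto)
  next
    case 2
    then obtain k where "g = 2 * k + 1" by (elim oddE)
    then have k: "g = 3 + 2 * (k - 1)" using assms by simp
    obtain l where l: "n = 2 * l" using 2 by (elim evenE)
    have strips: "(Suc 0, b) \<in> {0, Suc 0} \<times> {..<g} \<and> {0, 1} \<subseteq> f (Suc 0, b)" "a > Suc 0 \<Longrightarrow> (a, b) \<notin> {0, Suc 0} \<times> {..<g}"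
      if "b \<in> {3..<3 + 2 * (k - 1)}" for a b
      using that f(3)[of b] k by auto
    obtain f' where f': "toured ({0, Suc 0} \<times> {..<g} \<union> {Suc 0<..<n} \<times> {3..<3 + 2 * (k - 1)}) f'" "fresh f'"
      "\<forall>c\<in>{0, Suc 0} \<times> {..<g}. snd c \<notin> {3..<3 + 2 * (k - 1)} \<longrightarrow> f' c = f c"
      using toured_strips[OF f(1,2) strips assms(1)] by metis
    let ?D = "{0, Suc 0} \<times> {..<g} \<union> {Suc 0<..<n} \<times> {3..<3 + 2 * (k - 1)}"
    have "f' (Suc 0, 0) = f (Suc 0, 0)" "f' (Suc 0, Suc 0) = f (Suc 0, Suc 0)"
      using bspec[OF f'(3), of "(Suc 0, 0)"] bspec[OF f'(3), of "(Suc 0, Suc 0)"] assms by simp_all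
    then have top: "{0, 1} \<subseteq> f' (Suc 0, 0)" "0 \<in> f' (Suc 0, Suc 0)" using f(3) assms by auto
    have D: "(Suc 0, 0) \<in> ?D" "(Suc 0, Suc 0) \<in> ?D" "\<And>a b. a > Suc 0 \<Longrightarrow> b < 3 \<Longrightarrow> (a, b) \<notin> ?D"
      using assms by auto
    obtain h where h: "toured (?D \<union> {Suc 0<..Suc 0 + 2 * (l - 1)} \<times> {..<3}) h" "fresh h"
      using toured_triple_strip[OF f'(1,2) D top] by metis
    have "Suc 0 + 2 * (l - 1) = n - 1" using l assms by auto
    then show ?thesis by (intro weaken[OF h]) (use assms k in auto)
  next
    case 3
    then obtain k where "g = 2 * k + 1" by (elim oddE)
    then have k: "g = 3 + 2 * (k - 1)" using assms by simp
    obtain l where "n = 2 * l + 1" using 3 by (elim oddE)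
    then have l: "n = 3 + 2 * (l - 1)" using assms by simp
    have fr: "fresh fresh_3x3" unfolding fresh_def fresh_3x3_def by auto
    let ?B = "{0, 1, 2} \<times> {0, 1, 2::nat}"
    have b: "(0, 2) \<in> ?B" "(Suc 0, 2) \<in> ?B" "\<And>b. b > 2 \<Longrightarrow> (0, b) \<notin> ?B \<and> (Suc 0, b) \<notin> ?B"
      "even (2::nat) \<Longrightarrow> {1, 2} \<subseteq> fresh_3x3 (0, 2) \<and> 2 \<in> fresh_3x3 (Suc 0, 2)"
      "odd (2::nat) \<Longrightarrow> {3, 4} \<subseteq> fresh_3x3 (0, 2) \<and> 4 \<in> fresh_3x3 (Suc 0, 2)"
      by (auto simp: fresh_3x3_def)
    \<comment> \<open>The ladder stands on columns 0 and 1 only; column 2 above the seed is filled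
      by the strips.\<close>
    let ?L = "?B \<union> {0, Suc 0} \<times> {2<..2 + 2 * (k - 1)}"
    obtain f1 where f1: "toured ?L f1" "fresh f1" "\<forall>b\<in>{2<..2 + 2 * (k - 1)}. {0, 1} \<subseteq> f1 (Suc 0, b)"
      "\<forall>c\<in>?B - {(0, 2), (Suc 0, 2)}. f1 c = fresh_3x3 c"
      using toured_ladder[OF toured_3x3 fr b, of "2 * (k - 1)"] by metis
    have strips: "(Suc 0, b) \<in> ?L \<and> {0, 1} \<subseteq> f1 (Suc 0, b)" "a > Suc 0 \<Longrightarrow> (a, b) \<notin> ?L"
      if "b \<in> {3..<3 + 2 * (k - 1)}" for a b
    proof -
      have "b \<in> {2<..2 + 2 * (k - 1)}" using that by auto
      then show "(Suc 0, b) \<in> ?L \<and> {0, 1} \<subseteq> f1 (Suc 0, b)" using f1(3) by blast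
      show "a > Suc 0 \<Longrightarrow> (a, b) \<notin> ?L" using that by auto
    qed
    let ?D = "?L \<union> {Suc 0<..<n} \<times> {3..<3 + 2 * (k - 1)}"
    obtain f2 where f2: "toured ?D f2" "fresh f2"
      "\<forall>c\<in>?L. snd c \<notin> {3..<3 + 2 * (k - 1)} \<longrightarrow> f2 c = f1 c"
      using toured_strips[OF f1(1,2) strips assms(1)] by metis
    have "f2 (2, 0) = f1 (2, 0)" "f2 (2, Suc 0) = f1 (2, Suc 0)"
      using bspec[OF f2(3), of "(2, 0)"] bspec[OF f2(3), of "(2, Suc 0)"] by simp_all
    moreover have "f1 (2, 0) = fresh_3x3 (2, 0)" "f1 (2, Suc 0) = fresh_3x3 (2, Suc 0)"
      by (rule bspec[OF f1(4)]; simp)+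
    ultimately have top: "{0, 1} \<subseteq> f2 (2, 0)" "0 \<in> f2 (2, Suc 0)" by (auto simp: fresh_3x3_def)
    have D: "(2, 0) \<in> ?D" "(2, Suc 0) \<in> ?D" "\<And>a b. a > 2 \<Longrightarrow> b < 3 \<Longrightarrow> (a, b) \<notin> ?D"
      by auto
    obtain h where h: "toured (?D \<union> {2<..2 + 2 * (l - 1)} \<times> {..<3}) h" "fresh h"
      using toured_triple_strip[OF f2(1,2) D top] by metis
    have e: "{0, 1, 2::nat} = {..<3}" by auto
    show ?thesis by (rule weaken[OF h]) (use assms k l in \<open>unfold e, auto\<close>)
  qed
qed

section \<open>Stretching hexagons to longer cells\<close>

lemma ham_cycle_edges: "ham_cycle V E \<Longrightarrow> e \<in> E \<Longrightarrow> e \<subseteq> V"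
  unfolding ham_cycle_def using ham_path_edges ham_path_ends by fastforce

definition long_grid_edges :: "nat \<Rightarrow> (cell \<times> nat) set set" where
  "long_grid_edges L = {{(c, k), (c, Suc k mod L)} | c k. k < L}
    \<union> {{((a, b), k), ((Suc a, b), k)} | a b k. even k \<and> k < L}
    \<union> {{((a, b), k), ((a, Suc b), k)} | a b k. odd k \<and> k < L}"

lemma long_grid_cell_edge: "k < L \<Longrightarrow> {(c, k), (c, Suc k mod L)} \<in> long_grid_edges L"
  unfolding long_grid_edges_def by (intro UnI1, rule CollectI, intro exI conjI) simp_all

lemma long_grid_edge_right:
  "even k \<Longrightarrow> k < L \<Longrightarrow> {((a, b), k), ((Suc a, b), k)} \<in> long_grid_edges L"
  unfolding long_grid_edges_def by (rule UnI1, rule UnI2) (rule CollectI, intro exI conjI, simp_all)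

lemma long_grid_edge_up:
  "odd k \<Longrightarrow> k < L \<Longrightarrow> {((a, b), k), ((a, Suc b), k)} \<in> long_grid_edges L"
  unfolding long_grid_edges_def by (rule UnI2) (rule CollectI, intro exI conjI, simp_all)

lemma grid_edge_long:
  assumes "e \<in> grid_edges" "L \<ge> 6" "\<And>c. e \<noteq> cell_edge c 5"
  shows "e \<in> long_grid_edges L"
proof -
  consider c k where "e = cell_edge c k" "k < 6"
    | a b k where "e = {((a, b), k), ((Suc a, b), k)}" "even k" "k < 6"
    | a b k where "e = {((a, b), k), ((a, Suc b), k)}" "odd k" "k < 6"
    using assms(1) unfolding grid_edges_def cell_edges_def by (elim UnE UN_E imageE CollectE exE conjE) simp_all
  then show ?thesis
  proof cases
    case 1
    then have "k \<noteq> 5" using assms(3)[of c] by auto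
    then have "k < 5" "Suc k < L" using 1 assms(2) by auto
    then have "e = {(c, k), (c, Suc k mod L)}" using 1 unfolding cell_edge_def by simp
    then show ?thesis using long_grid_cell_edge[of k L c] \<open>Suc k < L\<close> by simp
  next
    case 2
    then show ?thesis using assms(2) by (simp add: long_grid_edge_right)
  next
    case 3
    then show ?thesis using assms(2) by (simp add: long_grid_edge_up)
  qed
qed

lemma ham_path_segment:
  assumes "i < j"
  shows "ham_path (c, i) (c, j - 1) ({c} \<times> {i..<j}) (path_edges (map (Pair c) [i..<j]))"
  unfolding ham_path_def using assms
  by (intro exI[of _ "map (Pair c) [i..<j]"])
     (auto simp: distinct_map inj_on_def hd_map last_map)

lemma path_edges_segment:
  "i \<le> j \<Longrightarrow> path_edges (map (Pair c) [i..<Suc j]) = (\<lambda>k. {(c, k), (c, Suc k)}) ` {i..<j}"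
proof (induction j rule: dec_induct)
  case (step j)
  have "path_edges (map (Pair c) [i..<Suc (Suc j)]) = path_edges (map (Pair c) [i..<Suc j] @ [(c, Suc j)])"
    using step(1) by simp
  also have "\<dots> = insert {(c, j), (c, Suc j)} (path_edges (map (Pair c) [i..<Suc j]))"
    using step(1) by (subst path_edges_append) (simp_all add: last_map)
  finally show ?case using step by (simp add: atLeastLessThanSuc)
qed simp

text \<open>Edge 5 of a hexagon joins positions 5 and 0. Replacing it by the path 5, 6, ..., L - 1,
  0 inserts the missing positions of the cell; for this purpose the tours never give up edge
  5.\<close>

lemma ham_cycle_long_grid:
  assumes t: "toured D (\<lambda>_. {5})" "finite D" and L: "L \<ge> 6"
  shows "\<exists>E. ham_cycle (D \<times> {..<L}) E \<and> E \<subseteq> long_grid_edges L"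
proof -
  obtain E0 where E0: "ham_cycle (D \<times> {..<6}) E0" "E0 \<subseteq> grid_edges" "\<And>c. c \<in> D \<Longrightarrow> cell_edge c 5 \<in> E0"
    using t(1) unfolding toured_def by auto
  have E0D: "c \<in> D" if "cell_edge c k \<in> E0" for c k
    using ham_cycle_edges[OF E0(1) that] unfolding cell_edge_def by auto
  show ?thesis
  proof (cases "L = 6")
    case True
    have "E0 \<subseteq> long_grid_edges L"
    proof
      fix e assume e: "e \<in> E0"
      show "e \<in> long_grid_edges L"
      proof (cases "\<exists>c. e = cell_edge c 5")
        case True
        then show ?thesis using long_grid_cell_edge[of 5 L] \<open>L = 6\<close> unfolding cell_edge_def by auto
      next
        case False
        then show ?thesis using grid_edge_long[of e L] e E0(2) L by blast
      qed
    qed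
    then show ?thesis using E0(1) True by blast
  next
    case False
    then have L: "6 < L" using L by simp
    \<comment> \<open>The cells of \<open>D'\<close> are already stretched. In the others edge 5 is
      still present, and it is the only kind of edge that may lie outside the long grid.\<close>
    have "\<exists>E. ham_cycle (D \<times> {..<6} \<union> D' \<times> {6..<L}) E
      \<and> (\<forall>e\<in>E. e \<in> long_grid_edges L \<or> (\<exists>c\<in>D - D'. e = cell_edge c 5))
      \<and> (\<forall>c\<in>D - D'. cell_edge c 5 \<in> E)" if "D' \<subseteq> D" for D'
      using finite_subset[OF that t(2)] that
    proof (induction D' rule: finite_induct)
      case empty
      have "e \<in> long_grid_edges L \<or> (\<exists>c\<in>D. e = cell_edge c 5)" if "e \<in> E0" for e
        using grid_edge_long[of e L] that E0(2) E0D L by (metis less_imp_le subsetD)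
      then show ?case using E0 by (intro exI[of _ E0]) auto
    next
      case (insert c D')
      obtain E where E: "ham_cycle (D \<times> {..<6} \<union> D' \<times> {6..<L}) E"
        "\<forall>e\<in>E. e \<in> long_grid_edges L \<or> (\<exists>c\<in>D - D'. e = cell_edge c 5)"
        "\<forall>c\<in>D - D'. cell_edge c 5 \<in> E"
        using insert by auto
      let ?V = "D \<times> {..<6} \<union> D' \<times> {6..<L}"
      let ?P = "path_edges (map (Pair c) [6..<L])"
      have c5: "cell_edge c 5 = {(c, 0), (c, 5)}" unfolding cell_edge_def by (simp add: insert_commute)
      have "{(c, 0), (c, 5)} \<in> E" using E(3) insert unfolding c5[symmetric] by simp
      from ham_cycle_cut[OF E(1) this]
      have p: "ham_path (c, 0) (c, 5) ?V (E - {cell_edge c 5})" unfolding c5 .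
      have "?V \<inter> {c} \<times> {6..<L} = {}" using insert by auto
      from ham_path_append[OF p ham_path_segment[OF L] this]
      have q: "ham_path (c, 0) (c, L - 1) (?V \<union> {c} \<times> {6..<L})
        (insert {(c, 5), (c, 6)} (E - {cell_edge c 5} \<union> ?P))" (is "ham_path _ _ _ ?F") .
      have nin: "{(c, 0), (c, L - 1)} \<notin> ?F"
      proof -
        have "{(c, 0), (c, L - 1)} \<notin> E"
          using ham_cycle_edges[OF E(1), of "{(c, 0), (c, L - 1)}"] insert L by auto
        moreover have "{(c, 0), (c, L - 1)} \<notin> ?P"
          using path_edges_subset[of "{(c, 0), (c, L - 1)}" "map (Pair c) [6..<L]"] by auto
        ultimately show ?thesis using L by (simp add: doubleton_eq_iff)
      qed
      have "ham_cycle (?V \<union> {c} \<times> {6..<L}) (insert {(c, 0), (c, L - 1)} ?F)"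
        by (rule ham_cycle_close[OF q _ nin]) (use L in auto)
      moreover have "?V \<union> {c} \<times> {6..<L} = D \<times> {..<6} \<union> insert c D' \<times> {6..<L}" by auto
      ultimately have cyc: "ham_cycle (D \<times> {..<6} \<union> insert c D' \<times> {6..<L}) (insert {(c, 0), (c, L - 1)} ?F)"
        by simp
      have all: "e \<in> long_grid_edges L \<or> (\<exists>c\<in>D - insert c D'. e = cell_edge c 5)"
        if e: "e \<in> insert {(c, 0), (c, L - 1)} ?F" for e
      proof -
        have new: "{(c, k), (c, Suc k)} \<in> long_grid_edges L" if "Suc k < L" for k
          using long_grid_cell_edge[of k L c] that by simp
        have P: "?P \<subseteq> long_grid_edges L"
          using path_edges_segment[of 6 "L - 1" c] L by (auto intro!: new)
        have "{(c, 0), (c, L - 1)} \<in> long_grid_edges L"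
          using long_grid_cell_edge[of "L - 1" L c] L by (simp add: insert_commute)
        moreover have "{(c, 5), (c, 6)} \<in> long_grid_edges L" using new[of 5] L by simp
        moreover have old: "e \<in> long_grid_edges L \<or> (\<exists>c\<in>D - insert c D'. e = cell_edge c 5)"
          if "e \<in> E" "e \<noteq> cell_edge c 5"
          using E(2) that by (metis DiffE DiffI insertE)
        ultimately show ?thesis using e P
          by (elim insertE UnE DiffE) (simp_all add: subset_iff)
      qed
      have keep: "cell_edge x 5 \<in> insert {(c, 0), (c, L - 1)} ?F" if "x \<in> D - insert c D'" for x
      proof -
        have "cell_edge x 5 \<noteq> cell_edge c 5" using that by (simp add: cell_edge_eq_iff)
        then show ?thesis using E(3) that by simp
      qed
      show ?case
        by (rule exI, intro conjI, rule cyc, rule ballI, erule all, rule ballI, erule keep)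
    qed
    from this[of D] obtain E where E: "ham_cycle (D \<times> {..<6} \<union> D \<times> {6..<L}) E" "E \<subseteq> long_grid_edges L"
      by auto
    have "D \<times> {..<6} \<union> D \<times> {6..<L} = D \<times> {..<L}" using L by auto
    then show ?thesis using E by auto
  qed
qed

section \<open>From edge sets to Hamilton cycles of a graph\<close>

lemma path_edges_successively:
  "(\<And>x y. {x, y} \<in> path_edges xs \<Longrightarrow> P x y) \<Longrightarrow> successively P xs"
  by (induction xs rule: path_edges.induct) auto

lemma hamiltonianI:
  assumes "distinct vs" "set vs = V" "length vs \<ge> 3" "successively adj vs" "adj (last vs) (hd vs)"
  shows "hamiltonian V adj"
proof -
  have ne: "vs \<noteq> []" using assms(3) by auto
  have "adj (vs ! i) (vs ! ((i + 1) mod length vs))" if "i < length vs" for i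
  proof (cases "Suc i = length vs")
    case True
    then have "i = length vs - 1" by simp
    then have "last vs = vs ! i" using ne by (simp add: last_conv_nth)
    then show ?thesis using assms(5) True ne by (simp add: hd_conv_nth)
  next
    case False
    then show ?thesis using that assms(4) by (simp add: successively_conv_nth)
  qed
  then show ?thesis unfolding hamiltonian_def using assms by blast
qed

lemma hamiltonian_of_ham_cycle:
  assumes c: "ham_cycle V E" and inj: "inj_on \<phi> V" and card: "card V \<ge> 3"
    and adj: "\<And>x y. {x, y} \<in> E \<Longrightarrow> adj (\<phi> x) (\<phi> y)"
  shows "hamiltonian (\<phi> ` V) adj"
proof -
  obtain x y F where F: "ham_path x y V F" "E = insert {y, x} F"
    using c unfolding ham_cycle_def by blast
  obtain xs where xs: "xs \<noteq> []" "distinct xs" "hd xs = x" "last xs = y" "set xs = V" "path_edges xs = F"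
    using F(1) unfolding ham_path_def by blast
  show ?thesis
  proof (rule hamiltonianI)
    show "distinct (map \<phi> xs)" using xs inj by (simp add: distinct_map)
    show "length (map \<phi> xs) \<ge> 3" using card xs by (metis distinct_card length_map)
    have "successively (\<lambda>x y. adj (\<phi> x) (\<phi> y)) xs"
      by (rule path_edges_successively) (use adj F xs in auto)
    then show "successively adj (map \<phi> xs)" by (simp add: successively_map)
    show "adj (last (map \<phi> xs)) (hd (map \<phi> xs))"
      using adj[of y x] F xs by (simp add: hd_map last_map)
  qed (use xs in auto)
qed

section \<open>A line of cells\<close>

text \<open>In contrast to \<open>ham_path\<close> no edge set is recorded: strands are only
  concatenated, never cut, so ends and vertex set suffice.\<close>

definition linked :: "('a \<Rightarrow> 'a \<Rightarrow> bool) \<Rightarrow> 'a \<Rightarrow> 'a \<Rightarrow> 'a set \<Rightarrow> bool" where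
  "linked adj x y V \<longleftrightarrow>
    (\<exists>xs. xs \<noteq> [] \<and> distinct xs \<and> hd xs = x \<and> last xs = y \<and> set xs = V \<and> successively adj xs)"

lemma linkedI:
  "xs \<noteq> [] \<Longrightarrow> distinct xs \<Longrightarrow> successively adj xs \<Longrightarrow> hd xs = x \<Longrightarrow> last xs = y \<Longrightarrow> set xs = V \<Longrightarrow>
    linked adj x y V"
  unfolding linked_def by blast

lemma successively_rev_symp: "symp adj \<Longrightarrow> successively adj (rev xs) \<longleftrightarrow> successively adj xs"
proof -
  assume "symp adj"
  then have "(\<lambda>x y. adj y x) = adj" by (auto simp: symp_def fun_eq_iff)
  then show ?thesis unfolding successively_rev by metis
qed

lemma linked_append:
  assumes "linked adj x y V" "linked adj z w W" "V \<inter> W = {}" "adj y z"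
  shows "linked adj x w (V \<union> W)"
proof -
  obtain xs ys where "xs \<noteq> []" "distinct xs" "hd xs = x" "last xs = y" "set xs = V" "successively adj xs"
    "ys \<noteq> []" "distinct ys" "hd ys = z" "last ys = w" "set ys = W" "successively adj ys"
    using assms(1,2) unfolding linked_def by blast
  then show ?thesis using assms(3,4)
    by (intro linkedI[of "xs @ ys"]) (auto simp: successively_append_iff)
qed

lemma linked_rev:
  assumes "linked adj x y V" "symp adj"
  shows "linked adj y x V"
proof -
  obtain xs where "xs \<noteq> []" "distinct xs" "hd xs = x" "last xs = y" "set xs = V" "successively adj xs"
    using assms(1) unfolding linked_def by blast
  then show ?thesis
    by (intro linkedI[of "rev xs"]) (auto simp: hd_rev last_rev successively_rev_symp[OF assms(2)]
      simp del: successively_rev)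
qed

lemma linked_map:
  assumes "linked adj x y V" "inj_on f V" "\<And>u v. adj u v \<Longrightarrow> adj (f u) (f v)"
  shows "linked adj (f x) (f y) (f ` V)"
proof -
  obtain xs where "xs \<noteq> []" "distinct xs" "hd xs = x" "last xs = y" "set xs = V" "successively adj xs"
    using assms(1) unfolding linked_def by blast
  then show ?thesis using assms(2,3)
    by (intro linkedI[of "map f xs"])
       (auto simp: distinct_map hd_map last_map successively_map intro: successively_mono)
qed

lemma linked_ends: "linked adj x y V \<Longrightarrow> x \<in> V \<and> y \<in> V"
  unfolding linked_def by auto

lemma hamiltonian_of_linked:
  assumes "linked adj x y V" "adj y x" "card V \<ge> 3"
  shows "hamiltonian V adj"
  using assms hamiltonianI distinct_card unfolding linked_def by metis

text \<open>Along a line of cells, the first cell is entered by the path from x to y, the inner ones are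
  crossed by the two disjoint paths, and the last one is closed by a path through the whole cell.\<close>

definition strands :: "('a \<Rightarrow> 'a \<Rightarrow> bool) \<Rightarrow> 'a set \<Rightarrow> 'a \<Rightarrow> 'a \<Rightarrow> 'a \<Rightarrow> 'a \<Rightarrow> bool" where
  "strands adj V x y z w \<longleftrightarrow> linked adj x y V \<and> linked adj z w V \<and>
    (\<exists>V1 V2. linked adj x z V1 \<and> linked adj y w V2 \<and> V = V1 \<union> V2 \<and> V1 \<inter> V2 = {})"

lemma strands_flip: "symp adj \<Longrightarrow> strands adj V x y z w \<Longrightarrow> strands adj V z w x y"
  unfolding strands_def using linked_rev by metis

text \<open>The two pairs of ends take turns. If the path through the cells so far ends in the
  copies of x and y, the two strands of the next cell prolong it on both sides, and it then ends in
  the copies of z and w; one cell later the ends are x and y again. The last cell is traversed as a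
  whole by the path between the current pair.\<close>

lemma hamiltonian_strands:
  fixes \<phi> :: "nat \<Rightarrow> 'a \<Rightarrow> 'a"
  assumes sym: "symp adj" and st: "strands adj V x y z w" and n: "n \<ge> 2" and card: "card V \<ge> 3"
    and inj: "\<And>k. k < n \<Longrightarrow> inj_on (\<phi> k) V"
    and hom: "\<And>k u v. adj u v \<Longrightarrow> adj (\<phi> k u) (\<phi> k v)"
    and link: "\<And>k p. Suc k < n \<Longrightarrow> p \<in> {x, y, z, w} \<Longrightarrow> adj (\<phi> k p) (\<phi> (Suc k) p)"
    and disj: "\<And>k l. k < n \<Longrightarrow> l < n \<Longrightarrow> k \<noteq> l \<Longrightarrow> \<phi> k ` V \<inter> \<phi> l ` V = {}"
  shows "hamiltonian (\<Union>k<n. \<phi> k ` V) adj"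
proof -
  have lm: "linked adj (\<phi> k a) (\<phi> k b) (\<phi> k ` U)" if "linked adj a b U" "k < n" "U \<subseteq> V" for k a b U
    using linked_map[OF that(1) inj_on_subset[OF inj[OF that(2)] that(3)] hom] .
  have un: "(\<Union>k<Suc (Suc j). \<phi> k ` V) = (\<Union>k<Suc j. \<phi> k ` V) \<union> \<phi> (Suc j) ` V" for j
    by (simp add: lessThan_Suc Un_commute)
  have dj: "(\<Union>k<Suc j. \<phi> k ` V) \<inter> \<phi> (Suc j) ` V = {}" if "Suc j < n" for j
  proof -
    have "\<phi> k ` V \<inter> \<phi> (Suc j) ` V = {}" if "k < Suc j" for k
      using disj[of k "Suc j"] that \<open>Suc j < n\<close> by auto
    then show ?thesis by blast
  qed
  have step: "linked adj (\<phi> (Suc j) r) (\<phi> (Suc j) t) (\<Union>k<Suc (Suc j). \<phi> k ` V)"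
    if j: "Suc j < n" and l: "linked adj (\<phi> j p) (\<phi> j q) (\<Union>k<Suc j. \<phi> k ` V)"
      and s: "strands adj V p q r t" "{p, q, r, t} \<subseteq> {x, y, z, w}" for j p q r t
  proof -
    obtain V1 V2 where V: "linked adj p r V1" "linked adj q t V2" "V = V1 \<union> V2" "V1 \<inter> V2 = {}"
      using s unfolding strands_def by blast
    let ?f = "\<phi> (Suc j)"
    have d: "?f ` V1 \<inter> ?f ` V2 = {}"
      using inj_on_image_Int[OF inj[OF j], of V1 V2] V(3,4) by simp
    have "linked adj (?f r) (\<phi> j q) (?f ` V1 \<union> (\<Union>k<Suc j. \<phi> k ` V))"
    proof (rule linked_append[OF linked_rev[OF lm[OF V(1) j] sym] l])
      show "?f ` V1 \<inter> (\<Union>k<Suc j. \<phi> k ` V) = {}" using dj[OF j] V(3) by blast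
      show "adj (?f p) (\<phi> j p)" using link[OF j, of p] s(2) sympD[OF sym] by auto
    qed (use V in auto)
    then have "linked adj (?f r) (?f t) ((?f ` V1 \<union> (\<Union>k<Suc j. \<phi> k ` V)) \<union> ?f ` V2)"
    proof (rule linked_append[OF _ lm[OF V(2) j]])
      show "(?f ` V1 \<union> (\<Union>k<Suc j. \<phi> k ` V)) \<inter> ?f ` V2 = {}" using dj[OF j] d V(3) by blast
      show "adj (\<phi> j q) (?f q)" using link[OF j, of q] s(2) by auto
    qed (use V in auto)
    moreover have "?f ` V = ?f ` V1 \<union> ?f ` V2" using V(3) by (simp add: image_Un)
    then have "(?f ` V1 \<union> (\<Union>k<Suc j. \<phi> k ` V)) \<union> ?f ` V2 = (\<Union>k<Suc (Suc j). \<phi> k ` V)"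
      unfolding un by (simp only: Un_ac)
    ultimately show ?thesis by metis
  qed
  have main: "j < n \<Longrightarrow> (even j \<longrightarrow> linked adj (\<phi> j x) (\<phi> j y) (\<Union>k<Suc j. \<phi> k ` V)) \<and>
      (odd j \<longrightarrow> linked adj (\<phi> j z) (\<phi> j w) (\<Union>k<Suc j. \<phi> k ` V))" for j
  proof (induction j)
    case 0
    have "(\<Union>k<Suc 0. \<phi> k ` V) = \<phi> 0 ` V" by auto
    then show ?case using lm[of x y V 0] st n unfolding strands_def by auto
  next
    case (Suc j)
    show ?case
    proof (cases "even j")
      case True
      then have "linked adj (\<phi> (Suc j) z) (\<phi> (Suc j) w) (\<Union>k<Suc (Suc j). \<phi> k ` V)"
        using step[OF Suc.prems _ st] Suc by auto
      then show ?thesis using True by simp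
    next
      case False
      then have "linked adj (\<phi> (Suc j) x) (\<phi> (Suc j) y) (\<Union>k<Suc (Suc j). \<phi> k ` V)"
        using step[OF Suc.prems _ strands_flip[OF sym st]] Suc by auto
      then show ?thesis using False by simp
    qed
  qed
  \<comment> \<open>Cells 0 to \<open>n - 2\<close> carry the growing path, and cell
    \<open>n - 1\<close> closes it.\<close>
  define j where "j = n - 2"
  have j: "n = Suc (Suc j)" using n unfolding j_def by simp
  have fin: "finite V" using card by (metis card.infinite not_numeral_le_zero)
  have "\<phi> 0 ` V \<subseteq> (\<Union>k<n. \<phi> k ` V)" using n by (intro UN_upper) auto
  then have "card (\<phi> 0 ` V) \<le> card (\<Union>k<n. \<phi> k ` V)" by (intro card_mono) (use fin in auto)
  then have card': "card (\<Union>k<n. \<phi> k ` V) \<ge> 3" using card card_image[OF inj[of 0]] n by simp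
  have close: "hamiltonian (\<Union>k<n. \<phi> k ` V) adj"
    if l: "linked adj (\<phi> j p) (\<phi> j q) (\<Union>k<Suc j. \<phi> k ` V)" and p: "linked adj p q V" "{p, q} \<subseteq> {x, y, z, w}" for p q
  proof -
    have "adj (\<phi> j q) (\<phi> (Suc j) q)" "adj (\<phi> j p) (\<phi> (Suc j) p)" using link[of j] p(2) j by auto
    moreover have "linked adj (\<phi> (Suc j) q) (\<phi> (Suc j) p) (\<phi> (Suc j) ` V)"
      using linked_rev[OF lm[OF p(1)] sym] j by auto
    ultimately have "linked adj (\<phi> j p) (\<phi> (Suc j) p) (\<Union>k<n. \<phi> k ` V)"
      using linked_append[OF l] dj[of j] unfolding j un by auto
    then show ?thesis using hamiltonian_of_linked[OF _ _ card'] \<open>adj (\<phi> j p) (\<phi> (Suc j) p)\<close> sympD[OF sym] by blast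
  qed
  show ?thesis using main[of j] close[of x y] close[of z w] st j unfolding strands_def by (cases "even j") auto
qed

section \<open>Strands from chords\<close>

definition closed_walk :: "('a \<Rightarrow> 'a \<Rightarrow> bool) \<Rightarrow> 'a list \<Rightarrow> bool" where
  "closed_walk adj xs \<longleftrightarrow> distinct xs \<and> successively adj xs \<and> adj (last xs) (hd xs)"

lemma closed_walk_rotate: "closed_walk adj (xs @ ys) \<Longrightarrow> closed_walk adj (ys @ xs)"
  by (cases "xs = []"; cases "ys = []") (auto simp: closed_walk_def successively_append_iff)

text \<open>In the cyclic order b, M1, e, M2, a, M3 one strand is M2 and the other runs through M3,
  a, b, e, M1 along both chords. Either chord alone yields a Hamilton path of the cell. The four
  ends are neighbours of a, b or e on the cycle, hence on the opposite side.\<close>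

lemma strands_two_chords:
  assumes c: "closed_walk h (b # M)" and h: "\<And>u v. h u v \<Longrightarrow> s u \<noteq> s v \<and> adj u v" and sym: "symp adj"
    and ae: "a \<in> set M" "e \<in> set M" "a \<noteq> e" "s a = s b" "s e = s b" "adj a b" "adj b e"
  obtains x y z w where "strands adj (set (b # M)) x y z w" "\<And>p. p \<in> {x, y, z, w} \<Longrightarrow> s p \<noteq> s b"
proof -
  note goal = that
  have main: thesis if M: "M = M1 @ e # M2 @ a # M3" and "adj a b" "adj b e" "s a = s b" "s e = s b" for a e M1 M2 M3
  proof -
    have dist: "distinct (b # M1 @ e # M2 @ a # M3)" using c unfolding closed_walk_def M by auto
    have "\<not> h b e" "\<not> h e a" "\<not> h a b" using h that(4,5) by metis+
    then have ne: "M1 \<noteq> []" "M2 \<noteq> []" "M3 \<noteq> []"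
      using c unfolding closed_walk_def M by (auto simp: successively_append_iff successively_Cons)
    have suc: "successively h M1" "successively h M2" "successively h M3"
      "h b (hd M1)" "h (last M1) e" "h e (hd M2)" "h (last M2) a" "h a (hd M3)" "h (last M3) b"
      using c ne unfolding closed_walk_def M by (auto simp: successively_append_iff successively_Cons)
    then have adj: "successively adj M1" "successively adj M2" "successively adj M3"
      using h by (auto intro: successively_mono)
    have adjs: "adj b (hd M1)" "adj (last M1) e" "adj e (hd M2)" "adj (last M2) a" "adj a (hd M3)" "adj (last M3) b"
      using suc h by auto
    note sy = adjs[THEN sympD[OF sym]] that(2,3)[THEN sympD[OF sym]]
    note simps = successively_append_iff successively_Cons hd_append last_append hd_rev last_rev
      successively_rev_symp[OF sym]
    have 1: "linked adj (last M2) (last M3) (set (b # M))"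
      by (rule linkedI[of "rev M2 @ [e] @ rev M1 @ [b, a] @ M3"])
         (use ne adj adjs sy dist that in \<open>auto simp: simps simp del: successively_rev\<close>)
    have 2: "linked adj (hd M2) (hd M1) (set (b # M))"
      by (rule linkedI[of "M2 @ [a] @ M3 @ [b, e] @ rev M1"])
         (use ne adj adjs sy dist that in \<open>auto simp: simps simp del: successively_rev\<close>)
    have 3: "linked adj (last M2) (hd M2) (set M2)"
      by (rule linkedI[of "rev M2"]) (use ne adj dist in \<open>auto simp: simps simp del: successively_rev\<close>)
    have 4: "linked adj (last M3) (hd M1) (set (M3 @ [a, b, e] @ M1))"
      by (rule linkedI[of "rev M3 @ [a, b, e] @ rev M1"])
         (use ne adj adjs sy dist that in \<open>auto simp: simps simp del: successively_rev\<close>)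
    have "set (b # M) = set M2 \<union> set (M3 @ [a, b, e] @ M1)" "set M2 \<inter> set (M3 @ [a, b, e] @ M1) = {}"
      unfolding M using dist by auto
    with 1 2 3 4 have "strands adj (set (b # M)) (last M2) (last M3) (hd M2) (hd M1)"
      unfolding strands_def by metis
    moreover have "s p \<noteq> s b" if "p \<in> {last M2, last M3, hd M2, hd M1}" for p
      using that suc h \<open>s a = s b\<close> \<open>s e = s b\<close> by fastforce
    ultimately show thesis by (rule goal)
  qed
  obtain N1 N2 where N: "M = N1 @ e # N2" using ae(2) by (meson split_list)
  show thesis
  proof (cases "a \<in> set N2")
    case True
    then obtain M2 M3 where "N2 = M2 @ a # M3" by (meson split_list)
    then show thesis using main[of N1 e M2 a M3] N ae by simp
  next
    case False
    then have "a \<in> set N1" using ae N by auto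
    then obtain M1 M2 where "N1 = M1 @ a # M2" by (meson split_list)
    then have "M = M1 @ a # M2 @ e # N2" using N by simp
    then show thesis using main[of M1 a M2 e N2] ae sympD[OF sym] by simp
  qed
qed

text \<open>As the chords do not cross, each belongs to a strand of its own: M1, b, a, M4 reversed,
  and M2, c, e, M3 reversed. Each chord alone yields one of the two Hamilton paths. The ends are the
  first vertices of the four arcs, on the side opposite to the chords.\<close>

lemma strands_parallel_chords:
  assumes c: "closed_walk h (a # M1 @ b # M2 @ c # M3 @ e # M4)"
    and h: "\<And>u v. h u v \<Longrightarrow> s u \<noteq> s v \<and> adj u v" and sym: "symp adj"
    and ch: "s b = s a" "s c = s a" "s e = s a" "adj a b" "adj c e"
  obtains x y z w where "strands adj (set (a # M1 @ b # M2 @ c # M3 @ e # M4)) x y z w"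
    "\<And>p. p \<in> {x, y, z, w} \<Longrightarrow> s p \<noteq> s a"
proof -
  let ?C = "a # M1 @ b # M2 @ c # M3 @ e # M4"
  have dist: "distinct ?C" using c unfolding closed_walk_def by auto
  have "\<not> h a b" "\<not> h b c" "\<not> h c e" "\<not> h e a" using h ch(1-3) by metis+
  moreover have "M1 = [] \<Longrightarrow> h a b" "M2 = [] \<Longrightarrow> h b c" "M3 = [] \<Longrightarrow> h c e" "M4 = [] \<Longrightarrow> h e a"
    using c unfolding closed_walk_def by (simp_all add: successively_append_iff successively_Cons)
  ultimately have ne: "M1 \<noteq> []" "M2 \<noteq> []" "M3 \<noteq> []" "M4 \<noteq> []" by auto
  have suc: "successively h M1" "successively h M2" "successively h M3" "successively h M4"
    "h a (hd M1)" "h (last M1) b" "h b (hd M2)" "h (last M2) c" "h c (hd M3)" "h (last M3) e"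
    "h e (hd M4)" "h (last M4) a"
    using c ne unfolding closed_walk_def by (simp_all add: successively_append_iff successively_Cons)
  then have adj: "successively adj M1" "successively adj M2" "successively adj M3" "successively adj M4"
    using h by (auto intro: successively_mono)
  have adjs: "adj a (hd M1)" "adj (last M1) b" "adj b (hd M2)" "adj (last M2) c" "adj c (hd M3)" "adj (last M3) e"
    "adj e (hd M4)" "adj (last M4) a"
    using suc h by auto
  note sy = adjs[THEN sympD[OF sym]] ch(4,5)[THEN sympD[OF sym]]
  note simps = successively_append_iff successively_Cons hd_append last_append hd_rev last_rev
      successively_rev_symp[OF sym]
  have 1: "linked adj (hd M1) (hd M2) (set ?C)"
    by (rule linkedI[of "M1 @ [b, a] @ rev M4 @ [e] @ rev M3 @ [c] @ rev M2"])
       (use ne adj adjs sy dist ch in \<open>auto simp: simps simp del: successively_rev\<close>)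
  have 2: "linked adj (hd M4) (hd M3) (set ?C)"
    by (rule linkedI[of "M4 @ [a] @ M1 @ [b] @ M2 @ [c, e] @ rev M3"])
       (use ne adj adjs sy dist ch in \<open>auto simp: simps simp del: successively_rev\<close>)
  have 3: "linked adj (hd M1) (hd M4) (set (M1 @ [b, a] @ M4))"
    by (rule linkedI[of "M1 @ [b, a] @ rev M4"]) (use ne adj adjs sy dist ch in \<open>auto simp: simps simp del: successively_rev\<close>)
  have 4: "linked adj (hd M2) (hd M3) (set (M2 @ [c, e] @ M3))"
    by (rule linkedI[of "M2 @ [c, e] @ rev M3"]) (use ne adj adjs sy dist ch in \<open>auto simp: simps simp del: successively_rev\<close>)
  have "set ?C = set (M1 @ [b, a] @ M4) \<union> set (M2 @ [c, e] @ M3)"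
    "set (M1 @ [b, a] @ M4) \<inter> set (M2 @ [c, e] @ M3) = {}"
    using dist by auto
  with 1 2 3 4 have "strands adj (set ?C) (hd M1) (hd M2) (hd M4) (hd M3)"
    unfolding strands_def by metis
  moreover have "s p \<noteq> s a" if "p \<in> {hd M1, hd M2, hd M4, hd M3}" for p
    using that suc h ch by fastforce
  ultimately show thesis by (rule that)
qed

lemma successively_upt:
  "(\<And>i. a \<le> i \<Longrightarrow> Suc i < b \<Longrightarrow> P i (Suc i)) \<Longrightarrow> successively P [a..<b]"
  by (simp add: successively_conv_nth)

lemma linked_nth:
  assumes "distinct C" "ks \<noteq> []" "distinct ks" "set ks \<subseteq> {..<length C}"
    "successively (\<lambda>i j. adj (C ! i) (C ! j)) ks"
  shows "linked adj (C ! hd ks) (C ! last ks) (nth C ` set ks)"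
proof (rule linkedI[of "map (nth C) ks"])
  have "inj_on (nth C) (set ks)" by (rule inj_on_nth) (use assms in auto)
  then show "distinct (map ((!) C) ks)" using assms by (simp add: distinct_map)
qed (use assms in \<open>auto simp: hd_map last_map successively_map\<close>)

lemma closed_walk_parity:
  fixes s :: "'a \<Rightarrow> bool"
  assumes "closed_walk h C" "\<And>u v. h u v \<Longrightarrow> s u \<noteq> s v" "i < length C"
  shows "s (C ! i) \<longleftrightarrow> (even i \<longleftrightarrow> s (C ! 0))"
  using assms(3)
proof (induction i)
  case (Suc i)
  have "h (C ! i) (C ! Suc i)"
    using assms(1) Suc.prems unfolding closed_walk_def by (auto simp: successively_conv_nth)
  then show ?case using assms(2) Suc by auto
qed simp

text \<open>A cycle with all its diameters is a Moebius ladder. Two neighbouring rungs, on 0, 1, N,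
  N + 1, form one strand; the other runs along the two remaining rails and changes over on the rung
  at N - 1. The four ends have even positions, so on an alternating cycle they share a side.\<close>

lemma strands_antipodal:
  assumes c: "closed_walk adj C" and sym: "symp adj" and N: "length C = 2 * N" "even N" "N \<ge> 4"
    and ch: "\<And>i. i < N \<Longrightarrow> adj (C ! i) (C ! (i + N))"
  shows "strands adj (set C) (C ! 2) (C ! N) (C ! (N + 2)) (C ! 0)"
proof -
  define P where "P i j \<longleftrightarrow> adj (C ! i) (C ! j)" for i j
  have dist: "distinct C" using c unfolding closed_walk_def by simp
  have P1: "P i (Suc i)" if "Suc i < 2 * N" for i
    using c that N unfolding closed_walk_def P_def by (auto simp: successively_conv_nth)
  have P2: "P i (i + N)" if "i < N" for i using ch that unfolding P_def .
  have Psym: "P i j \<Longrightarrow> P j i" for i j using sympD[OF sym] unfolding P_def .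
  have up: "successively P [a..<b]" if "b \<le> 2 * N" for a b
    by (rule successively_upt, rule P1) (use that in auto)
  have "symp P" using Psym unfolding symp_def by blast
  then have down: "successively P (rev [a..<b])" if "b \<le> 2 * N" for a b
    using up[OF that] by (simp add: successively_rev_symp del: successively_rev)
  have C: "nth C ` {..<2 * N} = set C" using N(1) by (auto simp: set_conv_nth)
  have lk: "linked adj (C ! a) (C ! b) (nth C ` V)"
    if "ks \<noteq> []" "distinct ks" "set ks = V" "V \<subseteq> {..<2 * N}" "successively P ks" "hd ks = a" "last ks = b" for ks a b V
    using linked_nth[OF dist that(1,2), of adj] that N(1) unfolding P_def by auto
  have "N - 1 + N = 2 * N - 1" using N(3) by simp
  then have e: "P (N - 1) (2 * N - 1)" using P2[of "N - 1"] N(3) by simp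
  note K = N(3)
  have "linked adj (C ! 2) (C ! N) (nth C ` {..<2 * N})"
  proof (rule lk[of "[2..<N] @ rev [N + 1..<2 * N] @ [1, 0, N]"])
    show "successively P ([2..<N] @ rev [N + 1..<2 * N] @ [1, 0, N])"
      using up[of N 2] down[of "2 * N" "N + 1"] e P2[of 0] Psym[OF P2[of 1]] Psym[OF P1[of 0]] K
      by (auto simp: successively_append_iff hd_rev last_rev simp del: successively_rev)
  qed (use K in auto)
  moreover have "linked adj (C ! (N + 2)) (C ! 0) (nth C ` {..<2 * N})"
  proof (rule lk[of "[N + 2..<2 * N] @ rev [1..<N] @ [N + 1, N, 0]"])
    show "successively P ([N + 2..<2 * N] @ rev [1..<N] @ [N + 1, N, 0])"
      using up[of "2 * N" "N + 2"] down[of N 1] Psym[OF e] P2[of 1] Psym[OF P2[of 0]] Psym[OF P1[of N]] K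
      by (auto simp: successively_append_iff hd_rev last_rev simp del: successively_rev)
  qed (use K in auto)
  moreover have "linked adj (C ! 2) (C ! (N + 2)) (nth C ` ({2..<N} \<union> {N + 2..<2 * N}))"
  proof (rule lk[of "[2..<N] @ rev [N + 2..<2 * N]"])
    show "successively P ([2..<N] @ rev [N + 2..<2 * N])"
      using up[of N 2] down[of "2 * N" "N + 2"] e K
      by (auto simp: successively_append_iff hd_rev last_rev simp del: successively_rev)
  qed (use K in \<open>auto simp: last_rev\<close>)
  moreover have "linked adj (C ! N) (C ! 0) (nth C ` {N, N + 1, 1, 0})"
  proof (rule lk[of "[N, N + 1, 1, 0]"])
    show "successively P [N, N + 1, 1, 0]"
      using P1[of N] Psym[OF P2[of 1]] Psym[OF P1[of 0]] K by auto
  qed (use K in auto)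
  moreover have "{..<2 * N} = ({2..<N} \<union> {N + 2..<2 * N}) \<union> {N, N + 1, 1, 0}" using K by auto
  then have "nth C ` {..<2 * N} = nth C ` ({2..<N} \<union> {N + 2..<2 * N}) \<union> nth C ` {N, N + 1, 1, 0}"
    by (metis image_Un)
  moreover have "nth C ` ({2..<N} \<union> {N + 2..<2 * N}) \<inter> nth C ` {N, N + 1, 1, 0} = {}"
  proof -
    have "inj_on (nth C) {..<2 * N}" by (rule inj_on_nth) (use dist N(1) in auto)
    moreover have "({2..<N} \<union> {N + 2..<2 * N}) \<inter> {N, N + 1, 1, 0} = {}" by auto
    moreover have "{2..<N} \<union> {N + 2..<2 * N} \<subseteq> {..<2 * N}" "{N, N + 1, 1, 0} \<subseteq> {..<2 * N}" using K by auto
    ultimately show ?thesis using inj_on_image_Int by (metis image_empty)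
  qed
  ultimately show ?thesis unfolding strands_def C by metis
qed

text \<open>With this count a bijection between the vertices of one side in two arcs becomes a
  statement about the lengths of the arcs.\<close>

lemma length_filter_alternating:
  fixes s :: "'a \<Rightarrow> bool"
  shows "successively (\<lambda>u v. s u \<noteq> s v) xs \<Longrightarrow> length (filter (\<lambda>u. s u = b) xs) =
    (if xs \<noteq> [] \<and> s (hd xs) = b then (length xs + 1) div 2 else length xs div 2)"
proof (induction xs)
  case (Cons a xs)
  then show ?case by (cases xs) auto
qed simp

text \<open>Two chords of one side that do not cross give strands directly. Otherwise each chord
  separates the ends of every other chord of its side, so \<open>t\<close> exchanges the vertices of
  that side between the two arcs. The arcs are then equally long and every chord is a
  diameter.\<close>

lemma strands_involution:
  fixes s :: "'a \<Rightarrow> bool"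
  assumes c: "closed_walk h C" and h: "\<And>u v. h u v \<Longrightarrow> s u \<noteq> s v \<and> adj u v" and sym: "symp adj"
    and len: "even (length C)" "length C \<ge> 6"
    and t: "\<And>v. v \<in> set C \<Longrightarrow> t v \<in> set C \<and> t (t v) = v \<and> t v \<noteq> v \<and> s (t v) = s v \<and> adj v (t v)"
  obtains x y z w b where "strands adj (set C) x y z w" "\<And>p. p \<in> {x, y, z, w} \<Longrightarrow> s p = b"
proof (cases "\<exists>v M1 M2 u. closed_walk h (v # M1 @ t v # M2) \<and> set C = set (v # M1 @ t v # M2) \<and>
    u \<in> set M2 \<and> t u \<in> set M2 \<and> s u = s v")
  case True
  then obtain v M1 M2 u where w: "closed_walk h (v # M1 @ t v # M2)" "set C = set (v # M1 @ t v # M2)"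
    "u \<in> set M2" "t u \<in> set M2" "s u = s v" by blast
  have uv: "u \<in> set C" "v \<in> set C" using w by auto
  obtain N1 N2 where N: "M2 = N1 @ u # N2" using w(3) by (meson split_list)
  have tu: "t u \<in> set N1 \<or> t u \<in> set N2" using w(4) N t[OF uv(1)] by auto
  have "\<exists>N1 N2 N3 c e. M2 = N1 @ c # N2 @ e # N3 \<and> s c = s v \<and> s e = s v \<and> adj c e"
  proof (cases "t u \<in> set N1")
    case True
    then obtain K1 K2 where "N1 = K1 @ t u # K2" by (meson split_list)
    then have "M2 = K1 @ t u # K2 @ u # N2" using N by simp
    then show ?thesis using t[OF uv(1)] w(5) sympD[OF sym] by metis
  next
    case False
    then obtain K1 K2 where "N2 = K1 @ t u # K2" using tu by (meson split_list)
    then have "M2 = N1 @ u # K1 @ t u # K2" using N by simp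
    then show ?thesis using t[OF uv(1)] w(5) by metis
  qed
  then obtain K1 K2 K3 c e where K: "M2 = K1 @ c # K2 @ e # K3" "s c = s v" "s e = s v" "adj c e" by blast
  obtain x y z w where "strands adj (set (v # M1 @ t v # K1 @ c # K2 @ e # K3)) x y z w"
    "\<And>p. p \<in> {x, y, z, w} \<Longrightarrow> s p \<noteq> s v"
    using strands_parallel_chords[where s = s, OF w(1)[unfolded K(1)] h sym] t[OF uv(2)] K by metis
  then show thesis using that[of x y z w "\<not> s v"] w(2) K(1) by simp
next
  case False
  obtain N where N: "length C = 2 * N" using len(1) by (elim evenE)
  have nonpar: False if "closed_walk h (v # M1 @ t v # M2)" "set C = set (v # M1 @ t v # M2)"
    "u \<in> set M2" "t u \<in> set M2" "s u = s v" for v M1 M2 u using False that by blast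
  have opp: "C ! (i + N) = t (C ! i)" if i: "i < N" for i
  proof -
    define v where "v = C ! i"
    define M where "M = drop (Suc i) C @ take i C"
    have "C = take i C @ v # drop (Suc i) C" unfolding v_def using i N by (simp add: id_take_nth_drop)
    then have w: "closed_walk h (v # M)" "set C = set (v # M)" "v \<in> set C"
      using closed_walk_rotate[of h "take i C" "v # drop (Suc i) C"] c unfolding M_def
      by (simp, metis Un_commute append_Cons set_append, metis in_set_conv_decomp)
    have lM: "length M = 2 * N - 1" unfolding M_def using i N by simp
    have tv: "t v \<in> set C" "t (t v) = v" "t v \<noteq> v" "s (t v) = s v" using t[OF w(3)] by auto
    obtain M1 M2 where M: "M = M1 @ t v # M2" using tv w(2) by (metis set_ConsD split_list)
    have w1: "closed_walk h (v # M1 @ t v # M2)" "set C = set (v # M1 @ t v # M2)" using w M by auto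
    have w2: "closed_walk h (t v # M2 @ t (t v) # M1)" "set C = set (t v # M2 @ t (t v) # M1)"
      using closed_walk_rotate[of h "v # M1" "t v # M2"] w1 tv by auto
    have dist: "distinct (v # M1 @ t v # M2)" using w1 unfolding closed_walk_def by blast
    have swap: "u \<in> set M1 \<Longrightarrow> s u = s v \<Longrightarrow> t u \<in> set M2" "u \<in> set M2 \<Longrightarrow> s u = s v \<Longrightarrow> t u \<in> set M1" for u
    proof -
      have gen: "t u \<in> set M1 \<or> t u \<in> set M2" if "u \<in> set M1 \<union> set M2"
      proof -
        have "u \<in> set C" "u \<noteq> v" "u \<noteq> t v" using that w1(2) dist by auto
        then have "t u \<in> set C" "t u \<noteq> v" "t u \<noteq> t v" using t w(3) by metis+
        then show ?thesis using w1(2) by auto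
      qed
      show "u \<in> set M1 \<Longrightarrow> s u = s v \<Longrightarrow> t u \<in> set M2"
        using gen nonpar[OF w2, of u] tv by auto
      show "u \<in> set M2 \<Longrightarrow> s u = s v \<Longrightarrow> t u \<in> set M1"
        using gen nonpar[OF w1, of u] by auto
    qed
    let ?F = "\<lambda>xs. {u \<in> set xs. s u = s v}"
    have sub: "set M1 \<subseteq> set C" "set M2 \<subseteq> set C" using w1 by auto
    have inj: "inj_on t (set C)" by (rule inj_onI) (metis t)
    have "t ` ?F M1 \<subseteq> ?F M2" using swap(1) t sub by auto
    then have le1: "card (?F M1) \<le> card (?F M2)"
      by (intro card_inj_on_le[OF inj_on_subset[OF inj]]) (use sub in auto)
    have "t ` ?F M2 \<subseteq> ?F M1" using swap(2) t sub by auto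
    then have le2: "card (?F M2) \<le> card (?F M1)"
      by (intro card_inj_on_le[OF inj_on_subset[OF inj]]) (use sub in auto)
    have fl: "length (filter (\<lambda>u. s u = s v) xs) = card (?F xs)" if "distinct xs" for xs
      using distinct_card[OF distinct_filter[OF that], of "\<lambda>u. s u = s v"] by simp
    have alt: "successively (\<lambda>u v. s u \<noteq> s v) M1" "successively (\<lambda>u v. s u \<noteq> s v) M2"
      "M1 \<noteq> [] \<Longrightarrow> s (hd M1) \<noteq> s v" "M2 \<noteq> [] \<Longrightarrow> s (hd M2) \<noteq> s v"
      using w1(1) h tv unfolding closed_walk_def
      by (auto simp: successively_append_iff successively_Cons intro: successively_mono)
    have "card (?F M1) = length M1 div 2"
      using length_filter_alternating[OF alt(1), of "s v"] alt(3) fl[of M1] dist by (auto split: if_splits)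
    moreover have "card (?F M2) = length M2 div 2"
      using length_filter_alternating[OF alt(2), of "s v"] alt(4) fl[of M2] dist by (auto split: if_splits)
    ultimately have "length M1 div 2 = length M2 div 2" using le1 le2 by simp
    moreover have "length M1 + length M2 = 2 * N - 2" using lM M by simp
    then have "even (length M1 + length M2)" by simp
    \<comment> \<open>Equal halves allow a difference of at most one, which the even sum
      excludes.\<close>
    ultimately have "length M1 = length M2" by presburger
    then have "length M1 = N - 1" using \<open>length M1 + length M2 = 2 * N - 2\<close> by simp
    then have "t v = M ! (N - 1)" unfolding M by (simp add: nth_append)
    also have "N - 1 < length (drop (Suc i) C)" using i N by simp
    then have "M ! (N - 1) = C ! (i + N)" unfolding M_def using i N by (simp add: nth_append)
    finally show ?thesis unfolding v_def by simp
  qed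
  have par: "s (C ! i) \<longleftrightarrow> (even i \<longleftrightarrow> s (C ! 0))" if "i < length C" for i
    by (rule closed_walk_parity[OF c]) (use h that in auto)
  have "N \<ge> 3" using len N by simp
  \<comment> \<open>A chord preserves the side while the cycle alternates, so half the length is
    even.\<close>
  have "s (C ! N) = s (C ! 0)" using opp[of 0] t[of "C ! 0"] \<open>N \<ge> 3\<close> N by simp
  then have "even N" using par[of N] \<open>N \<ge> 3\<close> N by auto
  then have N4: "N \<ge> 4" using \<open>N \<ge> 3\<close> by presburger
  have "closed_walk adj C"
    using c h unfolding closed_walk_def by (auto intro: successively_mono)
  from strands_antipodal[OF this sym N \<open>even N\<close> N4]
  have "strands adj (set C) (C ! 2) (C ! N) (C ! (N + 2)) (C ! 0)"
    using opp t N by simp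
  moreover have "s p = s (C ! 0)" if "p \<in> {C ! 2, C ! N, C ! (N + 2), C ! 0}" for p
    using that par[of 2] par[of N]
      par[of "N + 2"] N N4 \<open>even N\<close> by auto
  ultimately show thesis by (rule that)
qed

section \<open>Transversal lines in cyclic groups\<close>

lemma mod_add_right_cancel_nat: "(a + c) mod d = (b + c) mod d \<longleftrightarrow> a mod d = b mod (d :: nat)"
  by (simp add: nat_mod_eq_iff)

text \<open>The arguments are arbitrary representatives, not reduced modulo m, so that translation
  is plain addition.\<close>

definition step :: "nat \<Rightarrow> nat set \<Rightarrow> nat \<Rightarrow> nat \<Rightarrow> bool" where
  "step m X u v \<longleftrightarrow> (\<exists>x\<in>X. v mod m = (u + x) mod m)"

lemma step_add: "x \<in> X \<Longrightarrow> step m X u (u + x)"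
  unfolding step_def by auto

lemma step_shift: "step m X u v \<Longrightarrow> step m X (u + c) (v + c)"
  unfolding step_def by (metis add.assoc add.commute mod_add_left_eq)

lemma symp_step:
  assumes "X \<subseteq> {0..<m}" "\<forall>x\<in>X. (m - x) mod m \<in> X"
  shows "symp (step m X)"
proof (rule sympI)
  fix u v assume "step m X u v"
  then obtain x where x: "x \<in> X" "v mod m = (u + x) mod m" unfolding step_def by blast
  have "(v + (m - x) mod m) mod m = (v mod m + (m - x)) mod m" by (metis mod_add_eq mod_mod_trivial)
  also have "\<dots> = (u + x + (m - x)) mod m" unfolding x(2) by (simp add: mod_add_left_eq)
  also have "\<dots> = u mod m" using x(1) assms(1) by auto
  finally show "step m X v u" using x(1) assms(2) unfolding step_def by metis
qed

lemma card_multiples: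
  assumes "k dvd d" "d > (0::nat)"
  shows "card {i. i < d \<and> k dvd i} = d div k"
proof -
  have k: "k > 0" using assms by (auto intro: Nat.gr0I)
  have "{i. i < d \<and> k dvd i} = (\<lambda>j. k * j) ` {..<d div k}"
  proof (intro set_eqI iffI)
    fix i assume "i \<in> {i. i < d \<and> k dvd i}"
    then obtain j where "i = k * j" "k * j < d" by auto
    moreover have "d = k * (d div k)" using assms by simp
    ultimately show "i \<in> (\<lambda>j. k * j) ` {..<d div k}" using k by (metis imageI lessThan_iff nat_mult_less_cancel1)
  next
    fix i assume "i \<in> (\<lambda>j. k * j) ` {..<d div k}"
    then obtain j where j: "i = k * j" "j < d div k" by auto
    then have "k * j < k * (d div k)" using k by simp
    then show "i \<in> {i. i < d \<and> k dvd i}" using j assms by simp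
  qed
  moreover have "inj_on (\<lambda>j. k * j) {..<d div k}" using k by (auto simp: inj_on_def)
  ultimately show ?thesis by (simp add: card_image)
qed

text \<open>Steps are taken modulo m, where the edges live, but the places visited are read modulo
  d, which indexes the cells. Nothing is required of the two ends of the line.\<close>

definition transversal_line :: "nat \<Rightarrow> nat set \<Rightarrow> nat \<Rightarrow> nat \<Rightarrow> nat list \<Rightarrow> bool" where
  "transversal_line m X d k cs \<longleftrightarrow> cs \<noteq> [] \<and> successively (step m X) cs \<and>
    distinct (map (\<lambda>c. c mod d) cs) \<and> (\<lambda>c. c mod d) ` set cs = {i. i < d \<and> k dvd i}"

lemma transversal_line_length:
  assumes "transversal_line m X d k cs" "k dvd d" "d > 0"
  shows "length cs = d div k"
  using assms card_multiples[OF assms(2,3)] distinct_card[of "map (\<lambda>c. c mod d) cs"]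
  unfolding transversal_line_def by simp

text \<open>The new line runs through the translates of the old one by multiples of x, alternately forwards
  and backwards.\<close>

lemma transversal_line_insert:
  assumes sym: "symp (step m X)" and x: "x \<in> X" and k: "k dvd d" "d > 0"
    and cs: "transversal_line m X d k cs"
  shows "\<exists>ds. transversal_line m X d (gcd k x) ds"
proof -
  define g where "g = gcd k x"
  \<comment> \<open>The order of x modulo k: the translates by 0, x, ..., (q - 1) x lie in different
    classes modulo k, which \<open>qdvd\<close> makes precise, and together they fill the larger
    subgroup.\<close>
  define q where "q = k div g"
  have k0: "k > 0" using k by (auto intro: Nat.gr0I)
  have g0: "g > 0" using k0 unfolding g_def by simp
  have kq: "k = q * g" unfolding q_def g_def by simp
  have q0: "q > 0" using k0 kq by (auto intro: Nat.gr0I)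
  have gx: "g dvd x" "g dvd k" unfolding g_def by auto
  have qdvd: "q dvd n" if "k dvd n * x" for n
  proof -
    have x': "x = x div g * g" using gx by simp
    have cop: "coprime q (x div g)" unfolding q_def g_def using k0 by (intro div_gcd_coprime) simp
    have "q * g dvd n * (x div g) * g" using that kq x' by (metis mult.assoc)
    then have "q dvd n * (x div g)" using g0 by simp
    then show ?thesis using cop by (simp add: coprime_dvd_mult_left_iff)
  qed
  have c0: "cs \<noteq> []" "successively (step m X) cs" "distinct (map (\<lambda>c. c mod d) cs)"
    "(\<lambda>c. c mod d) ` set cs = {i. i < d \<and> k dvd i}"
    using cs unfolding transversal_line_def by auto
  have ck: "c mod k = 0" if "c \<in> set cs" for c
  proof -
    have "k dvd c mod d" using c0(4) that by auto
    then have "k dvd c" using k(1) by (simp add: dvd_mod_iff)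
    then show ?thesis by simp
  qed
  \<comment> \<open>Block j is the old line moved by j x and reversed for odd j, so that it begins x
    after the end of the preceding block.\<close>
  have "Suc j \<le> q \<Longrightarrow> \<exists>ds. ds \<noteq> [] \<and> successively (step m X) ds \<and> length ds = Suc j * length cs \<and>
    distinct (map (\<lambda>c. c mod d) ds) \<and> (\<forall>c\<in>set ds. \<exists>l\<le>j. c mod k = (l * x) mod k) \<and>
    last ds = (if even j then last cs else hd cs) + j * x" for j
  proof (induction j)
    case 0
    show ?case using c0 ck by (intro exI[of _ cs]) auto
  next
    case (Suc j)
    obtain ds where ds: "ds \<noteq> []" "successively (step m X) ds" "length ds = Suc j * length cs"
      "distinct (map (\<lambda>c. c mod d) ds)" "\<And>c. c \<in> set ds \<Longrightarrow> \<exists>l\<le>j. c mod k = (l * x) mod k"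
      "last ds = (if even j then last cs else hd cs) + j * x"
      using Suc by auto
    define es where "es = (if even j then rev cs else cs)"
    define fs where "fs = map (\<lambda>c. c + Suc j * x) es"
    have es: "es \<noteq> []" "set es = set cs" "length es = length cs" "successively (step m X) es"
      "hd es = (if even j then last cs else hd cs)" "last es = (if even j then hd cs else last cs)"
      "distinct (map (\<lambda>c. c mod d) es)"
      using c0 unfolding es_def
      by (auto simp: hd_rev last_rev successively_rev_symp[OF sym] rev_map[symmetric] simp del: successively_rev)
    have "successively (step m X) fs"
      unfolding fs_def successively_map using es(4) by (rule successively_mono) (rule step_shift)
    moreover have "step m X (last ds) (hd fs)"
    proof -
      have "hd fs = last ds + x" unfolding fs_def using es(1,5) ds(6) by (simp add: hd_map)
      then show ?thesis using step_add[OF x] by metis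
    qed
    ultimately have "successively (step m X) (ds @ fs)" using ds(2) by (simp add: successively_append_iff)
    moreover have fk: "c mod k = (Suc j * x) mod k" if "c \<in> set fs" for c
    proof -
      obtain c' where "c' \<in> set cs" "c = c' + Suc j * x" using \<open>c \<in> set fs\<close> es unfolding fs_def by auto
      then show ?thesis using ck[of c'] by (metis add_0 mod_add_left_eq)
    qed
    have "distinct (map (\<lambda>c. c mod d) fs)"
    proof -
      have "inj_on (\<lambda>c. c mod d) (set es)" "distinct es" using es(7) by (auto simp: distinct_map)
      moreover have "inj_on (\<lambda>c. (c + Suc j * x) mod d) (set es)"
      proof (rule inj_onI)
        fix a b assume ab: "a \<in> set es" "b \<in> set es" "(a + Suc j * x) mod d = (b + Suc j * x) mod d"
        then have "a mod d = b mod d" using mod_add_right_cancel_nat by blast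
        then show "a = b" using ab \<open>inj_on (\<lambda>c. c mod d) (set es)\<close> by (auto dest: inj_onD)
      qed
      ultimately show ?thesis unfolding fs_def by (simp add: distinct_map comp_def)
    qed
    moreover have "a mod d \<noteq> b mod d" if mem: "a \<in> set ds" "b \<in> set fs" for a b
    proof
      assume "a mod d = b mod d"
      then have "a mod k = b mod k" using k(1) by (metis mod_mod_cancel)
      then obtain l where l: "l \<le> j" "(l * x) mod k = (Suc j * x) mod k"
        using ds(5)[OF mem(1)] fk[OF mem(2)] by metis
      have "l * x \<le> Suc j * x" using l(1) by (intro mult_le_mono) simp_all
      then have "k dvd Suc j * x - l * x" using l(2) mod_eq_dvd_iff_nat by metis
      then have "k dvd (Suc j - l) * x" by (simp add: diff_mult_distrib)
      then have "q dvd Suc j - l" by (rule qdvd)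
      moreover have "0 < Suc j - l" "Suc j - l < q" using l(1) Suc.prems by auto
      ultimately show False by (auto dest: dvd_imp_le)
    qed
    then have "(\<lambda>c. c mod d) ` set ds \<inter> (\<lambda>c. c mod d) ` set fs = {}" by blast
    ultimately have "distinct (map (\<lambda>c. c mod d) (ds @ fs))" "successively (step m X) (ds @ fs)"
      using ds(4) by auto
    moreover have "\<forall>c\<in>set (ds @ fs). \<exists>l\<le>Suc j. c mod k = (l * x) mod k"
    proof
      fix c assume "c \<in> set (ds @ fs)"
      then consider "c \<in> set ds" | "c \<in> set fs" by auto
      then show "\<exists>l\<le>Suc j. c mod k = (l * x) mod k"
        by cases (use ds(5) le_SucI in blast, use fk in blast)
    qed
    moreover have "last (ds @ fs) = (if even (Suc j) then last cs else hd cs) + Suc j * x"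
      using es(1,6) unfolding fs_def by (simp add: last_map)
    moreover have "length (ds @ fs) = Suc (Suc j) * length cs" using ds(3) es(3) unfolding fs_def by simp
    ultimately show ?case using ds(1) by (intro exI[of _ "ds @ fs"]) simp
  qed
  from this[of "q - 1"] obtain ds where ds: "ds \<noteq> []" "successively (step m X) ds" "length ds = q * length cs"
    "distinct (map (\<lambda>c. c mod d) ds)" "\<forall>c\<in>set ds. \<exists>l\<le>q - 1. c mod k = (l * x) mod k"
    using q0 by auto
  have "(\<lambda>c. c mod d) ` set ds = {i. i < d \<and> g dvd i}"
  proof (rule card_subset_eq)
    show "(\<lambda>c. c mod d) ` set ds \<subseteq> {i. i < d \<and> g dvd i}"
    proof clarify
      fix c assume "c \<in> set ds"
      then obtain l where "c mod k = (l * x) mod k" using ds(5) by blast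
      then have "g dvd c mod k" using gx by (simp add: dvd_mod)
      then have "g dvd c" using gx by (simp add: dvd_mod_iff)
      then show "c mod d < d \<and> g dvd c mod d" using k gx(2) by (simp add: dvd_mod dvd_trans)
    qed
    have "card ((\<lambda>c. c mod d) ` set ds) = q * (d div k)"
      using distinct_card[OF ds(4)] ds(3) transversal_line_length[OF cs k] by simp
    also have "\<dots> = d div g" using k(1) kq g0 q0 by (auto elim!: dvdE)
    also have "\<dots> = card {i. i < d \<and> g dvd i}"
      using card_multiples[of g d] k gx(2) dvd_trans by metis
    finally show "card ((\<lambda>c. c mod d) ` set ds) = card {i. i < d \<and> g dvd i}" .
  qed simp
  then show ?thesis using ds unfolding transversal_line_def g_def by blast
qed

text \<open>The line consisting of 0 alone belongs to the empty set, and the elements of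
  \<open>Y\<close> are added one by one. The choice of \<open>Y\<close> is left free so that a
  smaller subgroup than the one generated by \<open>X\<close> can be aimed at.\<close>

lemma transversal_line_exists:
  assumes "symp (step m X)" "finite Y" "Y \<subseteq> X" "d > 0"
  shows "\<exists>cs. transversal_line m X d (gcd d (Gcd Y)) cs"
  using assms(2,3)
proof (induction Y rule: finite_induct)
  case empty
  have "transversal_line m X d d [0]"
    using assms(4) unfolding transversal_line_def by (auto dest: dvd_imp_le intro: ccontr)
  then show ?case by auto
next
  case (insert x Y)
  then obtain cs where cs: "transversal_line m X d (gcd d (Gcd Y)) cs" by auto
  have "x \<in> X" using insert by simp
  from transversal_line_insert[OF assms(1) this _ assms(4) cs]
  show ?case by (simp add: gcd.left_commute gcd.commute)
qed

section \<open>Bicirculants\<close>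

text \<open>Taking x to m - x pairs the elements below m/2 with those above it and leaves only m/2.
  For R and T of equal size, m/2 thus lies in both or in neither.\<close>

lemma card_symmetric_parity:
  fixes X :: "nat set"
  assumes X: "X \<subseteq> {0<..<m}" "\<forall>x\<in>X. m - x \<in> X"
  shows "odd (card X) \<longleftrightarrow> (\<exists>h\<in>X. 2 * h = m)"
proof -
  define A where "A = {x\<in>X. 2 * x < m}"
  define B where "B = {x\<in>X. 2 * x > m}"
  define H where "H = {x\<in>X. 2 * x = m}"
  have fin: "finite X" using X(1) finite_subset by blast
  have "bij_betw (\<lambda>x. m - x) A B"
    by (rule bij_betw_byWitness[where f' = "\<lambda>x. m - x"]) (use X in \<open>auto simp: A_def B_def\<close>)
  then have AB: "card A = card B" by (rule bij_betw_same_card)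
  have "X = A \<union> B \<union> H" "A \<inter> B = {}" "(A \<union> B) \<inter> H = {}" unfolding A_def B_def H_def by auto
  then have "card X = card A + card B + card H"
    using fin by (metis card_Un_disjoint finite_Un)
  then have c: "card X = 2 * card A + card H" using AB by simp
  show ?thesis
  proof (cases "\<exists>h\<in>X. 2 * h = m")
    case True
    then obtain h where "h \<in> X" "2 * h = m" by blast
    then have "H = {h}" unfolding H_def by auto
    then show ?thesis using c True by simp
  next
    case False
    then have "H = {}" unfolding H_def by auto
    then show ?thesis using c False by simp
  qed
qed

lemma gcd_Gcd_dvd: "gcd d (Gcd X) = d \<longleftrightarrow> (\<forall>x\<in>X. d dvd x)" for d :: nat
  by (metis dvd_Gcd_iff gcd_nat.absorb_iff1)

locale bicirculant =
  fixes m :: nat and R S T :: "nat set"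
  assumes m3: "m \<ge> 3" and subsets: "R \<subseteq> {0<..<m}" "S \<subseteq> {0..<m}" "T \<subseteq> {0<..<m}"
    and negR: "\<forall>j\<in>R. (m - j) mod m \<in> R" and negT: "\<forall>j\<in>T. (m - j) mod m \<in> T"
    and S0: "0 \<in> S"
begin

definition V where "V = bic_verts m"
text \<open>Indexing by the side lets one argument cover R and T.\<close>

definition X where "X s = (if s then T else R)"
definition adj where "adj u v \<longleftrightarrow> u \<in> V \<and> v \<in> V \<and> bic_adj m R S T u v"
definition hadj where "hadj u v \<longleftrightarrow> u \<in> V \<and> v \<in> V \<and> haar_adj m S u v"
definition d where "d = gcd_mS m S"
text \<open>The component of the vertex \<open>(False, 0)\<close> in the Haar graph, by
  \<open>component_K\<close>; its translates are the cells.\<close>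

definition K where "K = {v \<in> V. d dvd snd v}"
definition shift :: "nat \<Rightarrow> bool \<times> nat \<Rightarrow> bool \<times> nat" where
  "shift c v = (fst v, (snd v + c) mod m)"

lemma V_iff: "v \<in> V \<longleftrightarrow> snd v < m"
  unfolding V_def bic_verts_def by (cases v) auto

lemma X_props: "X s \<subseteq> {0<..<m}" "x \<in> X s \<Longrightarrow> m - x \<in> X s"
proof -
  show 1: "X s \<subseteq> {0<..<m}" using subsets unfolding X_def by auto
  assume x: "x \<in> X s"
  then have "(m - x) mod m \<in> X s" using negR negT unfolding X_def by (auto split: if_splits)
  moreover have "(m - x) mod m = m - x" using 1 x by auto
  ultimately show "m - x \<in> X s" by simp
qed

lemma finite_X: "finite (X s)"
  using X_props(1) finite_subset by blast

lemma sym_step: "symp (step m (X s))"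
proof (rule symp_step)
  show "X s \<subseteq> {0..<m}" using X_props(1)[of s] by auto
  show "\<forall>x\<in>X s. (m - x) mod m \<in> X s"
  proof
    fix x assume x: "x \<in> X s"
    then have "0 < x" using X_props(1)[of s] by auto
    then have "(m - x) mod m = m - x" using m3 by simp
    then show "(m - x) mod m \<in> X s" using X_props(2)[OF x] by simp
  qed
qed

lemma d_gcd: "d = gcd m (Gcd S)" unfolding d_def gcd_mS_def by simp

lemma d_pos: "d > 0" and d_dvd_m: "d dvd m" and d_dvd_S: "s \<in> S \<Longrightarrow> d dvd s"
  using m3 unfolding d_gcd by (auto intro: dvd_trans)

lemma adj_same_iff: "adj (s, i) (s, j) \<longleftrightarrow> i < m \<and> j < m \<and> (\<exists>x\<in>X s. j = (i + x) mod m)"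
  unfolding adj_def V_iff X_def by (cases s) auto

lemma adj_same_step: "i < m \<Longrightarrow> j < m \<Longrightarrow> adj (s, i) (s, j) \<longleftrightarrow> step m (X s) i j"
  unfolding adj_same_iff step_def by auto

lemma hadj_iff: "hadj (False, i) (True, j) \<longleftrightarrow> i < m \<and> j < m \<and> (\<exists>x\<in>S. j = (i + x) mod m)"
  "hadj (True, j) (False, i) \<longleftrightarrow> i < m \<and> j < m \<and> (\<exists>x\<in>S. j = (i + x) mod m)"
  "\<not> hadj (s, i) (s, j)"
  unfolding hadj_def V_iff haar_adj_def by (auto, cases s, auto)

lemma hadj_side: "hadj u v \<Longrightarrow> fst u \<noteq> fst v"
  by (cases u; cases v; cases "fst u"; cases "fst v") (auto simp: hadj_iff(3))

lemma hadj_adj: "hadj u v \<Longrightarrow> adj u v"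
proof -
  assume h: "hadj u v"
  obtain s i s' j where "u = (s, i)" "v = (s', j)" by (metis surj_pair)
  then show ?thesis using h hadj_side[OF h] unfolding hadj_def adj_def haar_adj_def
    by (cases s; cases s') auto
qed

lemma sym_hadj: "symp hadj"
proof (rule sympI)
  fix u v assume h: "hadj u v"
  obtain s i s' j where "u = (s, i)" "v = (s', j)" by (metis surj_pair)
  then show "hadj v u" using h hadj_side[OF h] by (cases s; cases s') (auto simp: hadj_iff)
qed

lemma sym_adj: "symp adj"
proof (rule sympI)
  fix u v assume a: "adj u v"
  obtain s i s' j where uv: "u = (s, i)" "v = (s', j)" by (metis surj_pair)
  show "adj v u"
  proof (cases "s = s'")
    case True
    have "i < m" "j < m" using a uv unfolding adj_def V_iff by auto
    then show ?thesis using a sympD[OF sym_step] unfolding uv True by (auto simp: adj_same_step)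
  next
    case False
    then have "hadj u v" using a uv unfolding adj_def hadj_def haar_adj_def
      by (cases s; cases s') auto
    then show ?thesis using sympD[OF sym_hadj] hadj_adj by blast
  qed
qed

section \<open>Rotations and the tiling by cells\<close>

lemma shift_V: "shift c v \<in> V"
  using m3 unfolding shift_def V_iff by simp

lemma shift_adj:
  assumes "adj u v"
  shows "adj (shift c u) (shift c v)"
proof -
  obtain s i s' j where uv: "u = (s, i)" "v = (s', j)" by (metis surj_pair)
  have eq: "((i + x) mod m + c) mod m = ((i + c) mod m + x) mod m" for i x
    by (simp add: mod_simps ac_simps)
  have ex: "(\<exists>x\<in>A. (j + c) mod m = ((i + c) mod m + x) mod m)" if "\<exists>x\<in>A. j = (i + x) mod m" for A i j
    using that eq by auto
  show ?thesis using assms ex[of _ i j] ex[of _ j i] shift_V[of c u] shift_V[of c v]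
    unfolding uv adj_def shift_def by (cases s; cases s') auto
qed

text \<open>Two translates of a vertex differ by the difference of the shifts, whatever the vertex
  is; only its side decides which of R and T has to provide the step.\<close>

lemma shift_link:
  assumes "v \<in> V" "step m (X (fst v)) c e"
  shows "adj (shift c v) (shift e v)"
proof -
  have "step m (X (fst v)) (snd v + c) (snd v + e)" using step_shift[OF assms(2), of "snd v"] by (simp add: add.commute)
  then obtain x where x: "x \<in> X (fst v)" "(snd v + e) mod m = (snd v + c + x) mod m"
    unfolding step_def by blast
  then have "(snd v + e) mod m = ((snd v + c) mod m + x) mod m" by (simp add: mod_simps)
  then show ?thesis using x(1) m3 unfolding shift_def adj_same_iff by auto
qed

lemma shift_inj: "inj_on (shift c) V"
proof (rule inj_onI)
  fix u v assume uv: "u \<in> V" "v \<in> V" "shift c u = shift c v"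
  then have "(snd u + c) mod m = (snd v + c) mod m" "fst u = fst v" unfolding shift_def by auto
  then have "snd u mod m = snd v mod m" using mod_add_right_cancel_nat by blast
  then show "u = v" using uv \<open>fst u = fst v\<close> unfolding V_iff by (simp add: prod_eq_iff)
qed

lemma shift_K: "v \<in> K \<Longrightarrow> snd (shift c v) mod d = c mod d"
proof -
  assume "v \<in> K"
  then have "snd v mod d = 0" unfolding K_def by simp
  then have "(snd v + c) mod d = c mod d" by (metis add_0 mod_add_left_eq)
  then show ?thesis unfolding shift_def using d_dvd_m by (simp add: mod_mod_cancel)
qed

lemma card_V: "card V = 2 * m"
  unfolding V_def bic_verts_def by (simp add: card_cartesian_product)

lemma finite_V: "finite V"
  unfolding V_def bic_verts_def by simp

lemma card_K: "card K = 2 * (m div d)"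
proof -
  have "K = UNIV \<times> {i. i < m \<and> d dvd i}" unfolding K_def V_iff by auto
  then show ?thesis using card_multiples[OF d_dvd_m] m3 by (simp add: card_cartesian_product)
qed

text \<open>The index modulo d identifies the translate, which gives injectivity; surjectivity is a
  count, since d cells of 2m/d vertices make 2m.\<close>

lemma tiling:
  assumes I: "finite I" "card I = d" "inj_on (\<lambda>i. c i mod d) I"
  shows "inj_on (\<lambda>(i, v). shift (c i) v) (I \<times> K)" "(\<lambda>(i, v). shift (c i) v) ` (I \<times> K) = V"
proof -
  show inj: "inj_on (\<lambda>(i, v). shift (c i) v) (I \<times> K)"
  proof (rule inj_onI)
    fix p q assume pq: "p \<in> I \<times> K" "q \<in> I \<times> K"
      "(case p of (i, v) \<Rightarrow> shift (c i) v) = (case q of (i, v) \<Rightarrow> shift (c i) v)"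
    obtain i u j v where e: "p = (i, u)" "q = (j, v)" by (metis surj_pair)
    have *: "i \<in> I" "u \<in> K" "j \<in> I" "v \<in> K" "shift (c i) u = shift (c j) v" using pq e by auto
    then have "c i mod d = c j mod d" using shift_K by metis
    then have ij: "i = j" using I(3) * by (auto dest: inj_onD)
    then have "u = v" using * inj_onD[OF shift_inj, of "c i" u v] unfolding K_def by auto
    then show "p = q" using ij e by simp
  qed
  show "(\<lambda>(i, v). shift (c i) v) ` (I \<times> K) = V"
  proof (rule card_subset_eq[OF finite_V])
    show "(\<lambda>(i, v). shift (c i) v) ` (I \<times> K) \<subseteq> V" using shift_V by auto
    show "card ((\<lambda>(i, v). shift (c i) v) ` (I \<times> K)) = card V"
      using card_image[OF inj] I(2) card_K card_V d_dvd_m by (simp add: card_cartesian_product)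
  qed
qed

lemma hamiltonian_adj: "hamiltonian V adj \<Longrightarrow> hamiltonian (bic_verts m) (bic_adj m R S T)"
  unfolding hamiltonian_def V_def[symmetric] adj_def by blast

section \<open>The component of the cyclic Haar graph\<close>

text \<open>Spokes preserve divisibility of the index by d, so the component lies in
  \<open>K\<close>. Conversely, because 0 is in S, a spoke from u_i to v_(i+x) can be followed by
  the spoke to u_(i+x). These moves by elements of S and their inverses reach all multiples of
  d.\<close>

lemma component_K: "component_of (bic_verts m) (haar_adj m S) (False, 0) = K"
proof -
  have rel: "(\<lambda>a b. a \<in> bic_verts m \<and> b \<in> bic_verts m \<and> haar_adj m S a b) = hadj"
    unfolding hadj_def V_def by (simp add: fun_eq_iff)
  have inv: "d dvd snd v \<longleftrightarrow> d dvd snd u" if h: "hadj u v" for u v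
  proof -
    obtain s i s' j where uv: "u = (s, i)" "v = (s', j)" by (metis surj_pair)
    have "d dvd (i + x) mod m \<longleftrightarrow> d dvd i" if "x \<in> S" for i x
      using d_dvd_S[OF that] d_dvd_m by (simp add: dvd_mod_iff dvd_add_left_iff)
    then show ?thesis using h hadj_side[OF h] unfolding uv
      by (cases s; cases s') (auto simp: hadj_iff)
  qed
  have 1: "d dvd snd v" if "hadj\<^sup>*\<^sup>* (False, 0) v" for v
    using that by (induction rule: rtranclp_induct) (use inv in auto)
  \<comment> \<open>Negatives are added because \<open>transversal_line_exists\<close> asks for a
    symmetric step relation; they correspond to moves run backwards.\<close>
  define Y where "Y = S \<union> (\<lambda>x. (m - x) mod m) ` S"
  have Y: "Y \<subseteq> {0..<m}" using subsets m3 unfolding Y_def by auto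
  have "(m - (m - x) mod m) mod m = x" if "x < m" for x using that by (cases "x = 0") auto
  then have "\<forall>x\<in>Y. (m - x) mod m \<in> Y" using subsets unfolding Y_def by auto
  then have sym: "symp (step m Y)" by (rule symp_step[OF Y])
  have finS: "finite S" using subsets finite_subset by blast
  \<comment> \<open>Here the modulus is m itself, so the line visits every multiple of d below
    m.\<close>
  obtain cs where cs: "transversal_line m Y m d cs"
    using transversal_line_exists[OF sym finS, of m] m3 unfolding d_gcd Y_def by auto
  have sp: "hadj\<^sup>*\<^sup>* (False, i mod m) (False, j mod m)" if "step m Y i j" for i j
  proof -
    have mm: "m > 0" using m3 by simp
    have base: "hadj\<^sup>*\<^sup>* (False, i mod m) (False, j mod m)" if "x \<in> S" "j mod m = (i + x) mod m" for i j x
    proof -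
      have "hadj (False, i mod m) (True, j mod m)"
        using that mm unfolding hadj_iff by (auto simp: mod_simps intro!: bexI[of _ x])
      moreover have "hadj (True, j mod m) (False, j mod m)"
        using S0 mm unfolding hadj_iff by (auto intro!: bexI[of _ 0])
      ultimately show ?thesis by (meson converse_rtranclp_into_rtranclp r_into_rtranclp)
    qed
    obtain x where x: "x \<in> Y" "j mod m = (i + x) mod m" using \<open>step m Y i j\<close> unfolding step_def by blast
    show ?thesis
    proof (cases "x \<in> S")
      case True
      then show ?thesis using base x by blast
    next
      case False
      then obtain y where y: "y \<in> S" "x = (m - y) mod m" using x unfolding Y_def by auto
      have "(j + y) mod m = ((i + x) mod m + y) mod m" using x(2) by (metis mod_add_left_eq)
      also have "\<dots> = (i + (m - y + y)) mod m" unfolding y(2) by (simp add: mod_simps ac_simps)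
      also have "\<dots> = i mod m" using y(1) subsets by auto
      finally have "hadj\<^sup>*\<^sup>* (False, j mod m) (False, i mod m)" using base[OF y(1)] by metis
      then show ?thesis using sym_hadj by (metis symp_rtranclp sympD)
    qed
  qed
  have reach: "hadj\<^sup>*\<^sup>* (False, cs ! 0 mod m) (False, cs ! i mod m)" if "i < length cs" for i
    using that
  proof (induction i)
    case (Suc i)
    have "step m Y (cs ! i) (cs ! Suc i)"
      using cs Suc.prems unfolding transversal_line_def by (auto simp: successively_conv_nth)
    then show ?case using sp Suc by (meson Suc_lessD rtranclp_trans)
  qed simp
  have 2: "hadj\<^sup>*\<^sup>* (False, cs ! 0 mod m) (False, i)" if "i < m" "d dvd i" for i
  proof -
    have "i \<in> (\<lambda>c. c mod m) ` set cs" using cs that unfolding transversal_line_def by simp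
    then show ?thesis using reach by (auto simp: in_set_conv_nth)
  qed
  \<comment> \<open>The line need not start at 0, so 0 is first joined to its start by a reversed
    walk.\<close>
  have 3: "hadj\<^sup>*\<^sup>* (False, 0) (False, i)" if "i < m" "d dvd i" for i
  proof -
    have "hadj\<^sup>*\<^sup>* (False, 0) (False, cs ! 0 mod m)"
      using 2[of 0] m3 sym_hadj by (metis symp_rtranclp sympD dvd_0_right gr_zeroI not_numeral_le_zero)
    then show ?thesis using 2[OF that] by (rule rtranclp_trans)
  qed
  have 4: "hadj\<^sup>*\<^sup>* (False, 0) v" if "v \<in> K" for v
  proof -
    obtain s i where v: "v = (s, i)" by (cases v)
    have i: "i < m" "d dvd i" using that unfolding v K_def V_iff by auto
    have "hadj (False, i) (True, i)" using S0 i unfolding hadj_iff by (auto intro!: bexI[of _ 0])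
    then have "hadj\<^sup>*\<^sup>* (False, 0) (True, i)" using 3[OF i] by simp
    then show ?thesis using 3[OF i] unfolding v by (cases s) auto
  qed
  have "component_of (bic_verts m) (haar_adj m S) (False, 0) = {v \<in> V. hadj\<^sup>*\<^sup>* (False, 0) v}"
    unfolding component_of_def rel V_def ..
  also have "\<dots> = K"
  proof (intro set_eqI iffI)
    fix v assume "v \<in> {v \<in> V. hadj\<^sup>*\<^sup>* (False, 0) v}"
    then show "v \<in> K" using 1[of v] unfolding K_def by simp
  next
    fix v assume v: "v \<in> K"
    then show "v \<in> {v \<in> V. hadj\<^sup>*\<^sup>* (False, 0) v}" using 4[OF v] unfolding K_def by simp
  qed
  finally show ?thesis .
qed

lemma haar_cycle:
  assumes "hamiltonian (component_of (bic_verts m) (haar_adj m S) (False, 0)) (haar_adj m S)"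
  obtains C where "closed_walk hadj C" "set C = K"
proof -
  obtain C where C: "distinct C" "set C = K" "length C \<ge> 3"
    "\<And>i. i < length C \<Longrightarrow> haar_adj m S (C ! i) (C ! ((i + 1) mod length C))"
    using assms unfolding component_K hamiltonian_def by blast
  have h: "hadj (C ! i) (C ! ((i + 1) mod length C))" if "i < length C" for i
  proof -
    have "(i + 1) mod length C < length C" using C(3) by (intro mod_less_divisor) auto
    then have "C ! i \<in> K" "C ! ((i + 1) mod length C) \<in> K" using that C(2) nth_mem by metis+
    then show ?thesis using C(4)[OF that] unfolding hadj_def K_def by simp
  qed
  have ne: "C \<noteq> []" using C(3) by auto
  have "successively hadj C" unfolding successively_conv_nth
  proof (intro allI impI)
    fix i assume "Suc i < length C"
    then show "hadj (C ! i) (C ! Suc i)" using h[of i] by simp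
  qed
  moreover have "Suc (length C - 1) = length C" using ne by (cases C) auto
  then have "hadj (last C) (hd C)" using h[of "length C - 1"] ne
    by (simp add: last_conv_nth hd_conv_nth)
  ultimately show thesis using that C(1,2) unfolding closed_walk_def by blast
qed

lemma closed_walk_from:
  assumes "closed_walk hadj C" "v \<in> set C"
  obtains M where "closed_walk hadj (v # M)" "set (v # M) = set C"
proof -
  obtain us ws where "C = us @ v # ws" using assms(2) by (meson split_list)
  then have "closed_walk hadj (v # ws @ us)" "set (v # ws @ us) = set C"
    using closed_walk_rotate[of hadj us "v # ws"] assms(1) by auto
  then show thesis by (rule that)
qed

lemma K_iff: "(s, i) \<in> K \<longleftrightarrow> i < m \<and> d dvd i"
  unfolding K_def V_iff by simp

lemma hadj_facts: "hadj u v \<Longrightarrow> fst u \<noteq> fst v \<and> adj u v"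
  using hadj_side hadj_adj by blast

section \<open>Assembling the cells along lines and grids\<close>

lemma inj_on_line:
  assumes "transversal_line m Y e k cs" "k dvd e" "e > 0"
  shows "inj_on (\<lambda>i. cs ! i mod e) {..<e div k}"
proof -
  have "distinct (map (\<lambda>c. c mod e) cs)" using assms(1) unfolding transversal_line_def by blast
  from inj_on_nth[OF this, of "{..<e div k}"] transversal_line_length[OF assms]
  have "inj_on ((!) (map (\<lambda>c. c mod e) cs)) {..<e div k}" by simp
  then show ?thesis
    by (rule inj_on_cong[THEN iffD1, rotated]) (simp add: transversal_line_length[OF assms])
qed

lemma step_line:
  assumes "transversal_line m Y e k cs" "Suc i < length cs"
  shows "step m Y (cs ! i) (cs ! Suc i)"
  using assms unfolding transversal_line_def by (auto simp: successively_conv_nth)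

lemma hamiltonian_by_strands:
  assumes st: "strands adj K x y z w" and side: "\<And>p. p \<in> {x, y, z, w} \<Longrightarrow> fst p = s"
    and line: "transversal_line m (X s) d 1 cs" and d: "d \<ge> 2" and card: "card K \<ge> 3"
  shows "hamiltonian V adj"
proof -
  have len: "length cs = d" using transversal_line_length[OF line _ d_pos] by simp
  have inj: "inj_on (\<lambda>i. cs ! i mod d) {..<d}" using inj_on_line[OF line _ d_pos] by simp
  have KV: "K \<subseteq> V" unfolding K_def by auto
  have t: "inj_on (\<lambda>(i, v). shift (cs ! i) v) ({..<d} \<times> K)" "(\<lambda>(i, v). shift (cs ! i) v) ` ({..<d} \<times> K) = V"
    using tiling[of "{..<d}" "\<lambda>i. cs ! i"] inj by auto
  have "(\<Union>k<d. shift (cs ! k) ` K) = V" unfolding t(2)[symmetric] by auto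
  moreover have "hamiltonian (\<Union>k<d. shift (cs ! k) ` K) adj"
  proof (rule hamiltonian_strands[OF sym_adj st d card])
    show "inj_on (shift (cs ! k)) K" for k using inj_on_subset[OF shift_inj KV] .
    show "adj u v \<Longrightarrow> adj (shift (cs ! k) u) (shift (cs ! k) v)" for k u v by (rule shift_adj)
    show "shift (cs ! k) ` K \<inter> shift (cs ! l) ` K = {}" if "k < d" "l < d" "k \<noteq> l" for k l
    proof -
      have False if "u \<in> K" "v \<in> K" "shift (cs ! k) u = shift (cs ! l) v" for u v
        using inj_onD[OF t(1), of "(k, u)" "(l, v)"] that \<open>k < d\<close> \<open>l < d\<close> \<open>k \<noteq> l\<close> by auto
      then show ?thesis by blast
    qed
    show "adj (shift (cs ! k) p) (shift (cs ! Suc k) p)" if k: "Suc k < d" and p: "p \<in> {x, y, z, w}" for k p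
    proof -
      have "x \<in> K" "y \<in> K" "z \<in> K" "w \<in> K" using st linked_ends unfolding strands_def by metis+
      then have "p \<in> V" using p KV by auto
      then show ?thesis using shift_link[of p] side[OF p] step_line[OF line] k len by simp
    qed
  qed
  ultimately show ?thesis by simp
qed

text \<open>As 2x differs from m, the elements x and m - x are distinct, and the vertex
  \<open>(s, 0)\<close> has two chords within its cell. The ends of the strands then lie on the
  other side, which is why the line has steps from \<open>X (\<not> s)\<close>.\<close>

lemma hamiltonian_by_chords:
  assumes C: "closed_walk hadj C" "set C = K" and x: "x \<in> X s" "d dvd x" "2 * x \<noteq> m"
    and line: "transversal_line m (X (\<not> s)) d 1 cs" and d: "d \<ge> 2" and card: "card K \<ge> 3"
  shows "hamiltonian V adj"
proof -
  let ?b = "(s, 0)" and ?a = "(s, x)" and ?e = "(s, m - x)"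
  have xm: "0 < x" "x < m" "m - x \<in> X s" using X_props(2)[OF x(1)] subsetD[OF X_props(1) x(1)] by auto
  have b: "?b \<in> K" "?a \<in> K" "?e \<in> K" using m3 xm x(2) d_dvd_m by (auto simp: K_iff)
  obtain M where M: "closed_walk hadj (?b # M)" "set (?b # M) = K"
    using closed_walk_from[OF C(1)] b C(2) by metis
  have "?a \<in> set (?b # M)" "?e \<in> set (?b # M)" unfolding M(2) using b by auto
  then have aM: "?a \<in> set M" "?e \<in> set M" using xm by auto
  have ne: "?a \<noteq> ?e" using x(3) xm by auto
  have "adj ?b ?a" unfolding adj_same_iff using xm x(1) by (auto intro!: bexI[of _ x])
  moreover have "adj ?b ?e" unfolding adj_same_iff using xm by (auto intro!: bexI[of _ "m - x"])
  ultimately have ba: "adj ?b ?a" "adj ?b ?e" .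
  then have ab: "adj ?a ?b" using sympD[OF sym_adj] by blast
  obtain p y z w where st: "strands adj (set (?b # M)) p y z w" "\<And>q. q \<in> {p, y, z, w} \<Longrightarrow> fst q \<noteq> fst ?b"
    by (rule strands_two_chords[where s = fst, OF M(1) hadj_facts sym_adj aM ne _ _ ab ba(2)]) simp_all
  show ?thesis
    by (rule hamiltonian_by_strands[OF st(1)[unfolded M(2)] _ line d card]) (use st(2) in auto)
qed

text \<open>Translation by h is an involution with chords on both sides. Which side the ends of the
  strands get is decided by \<open>strands_involution\<close>, so lines for both sides must be at
  hand.\<close>

lemma hamiltonian_by_halves:
  assumes C: "closed_walk hadj C" "set C = K" and h: "\<And>s. h \<in> X s" "d dvd h" "2 * h = m"
    and line: "\<And>s. \<exists>cs. transversal_line m (X s) d 1 cs" and d: "d \<ge> 2" and L: "m div d \<ge> 3"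
  shows "hamiltonian V adj"
proof -
  define t where "t v = (fst v, (snd v + h) mod m)" for v :: "bool \<times> nat"
  have len: "length C = 2 * (m div d)"
    using distinct_card[of C] C card_K unfolding closed_walk_def by simp
  have t: "t v \<in> set C \<and> t (t v) = v \<and> t v \<noteq> v \<and> fst (t v) = fst v \<and> adj v (t v)" if v: "v \<in> set C" for v
  proof -
    obtain s i where si: "v = (s, i)" by (cases v)
    have i: "i < m" "d dvd i" using v C(2) unfolding si by (auto simp: K_iff)
    have "d dvd (i + h) mod m" using i h(2) d_dvd_m by (simp add: dvd_mod)
    then have 1: "t v \<in> set C" using m3 unfolding C(2) t_def si by (simp add: K_iff)
    have "((i + h) mod m + h) mod m = (i + 2 * h) mod m" by (simp add: mod_simps mult_2 add.assoc)
    also have "\<dots> = i" using h(3) i by simp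
    finally have 2: "t (t v) = v" unfolding t_def si by simp
    have "(i + h) mod m \<noteq> i"
    proof
      assume "(i + h) mod m = i"
      then have "(h + i) mod m = (0 + i) mod m" using i by (simp add: add.commute)
      then have "h mod m = 0 mod m" using mod_add_right_cancel_nat by blast
      then show False using h(3) m3 by auto
    qed
    then have 3: "t v \<noteq> v" unfolding t_def si by simp
    have 4: "adj v (t v)" unfolding t_def si using i h(1) m3 by (auto simp: adj_same_iff)
    show ?thesis using 1 2 3 4 by (simp add: t_def)
  qed
  have ev: "even (length C)" "length C \<ge> 6" using len L by auto
  obtain x y z w b where st: "strands adj (set C) x y z w" "\<And>p. p \<in> {x, y, z, w} \<Longrightarrow> fst p = b"
    using strands_involution[where s = fst, OF C(1) hadj_facts sym_adj ev t] by metis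
  obtain cs where "transversal_line m (X b) d 1 cs" using line by blast
  moreover have "card K \<ge> 3" using card_K L by simp
  ultimately show ?thesis using hamiltonian_by_strands[OF st(1)[unfolded C(2)] st(2)] d by blast
qed

text \<open>Cell (a, b) is the translate by \<open>\<alpha> ! a + \<beta> ! b\<close>, where
  \<open>\<alpha>\<close> runs through the multiples of k modulo d by steps from \<open>X s\<close>
  and \<open>\<beta>\<close> through their cosets by steps from \<open>X (\<not> s)\<close>.
  Choosing \<open>Y\<close> inside \<open>X s\<close> gives a proper subgroup even if
  \<open>X s\<close> generates everything.\<close>

lemma hamiltonian_by_grid:
  assumes C0: "closed_walk hadj C0" "set C0 = K" and Y: "Y \<subseteq> X s" "k = gcd d (Gcd Y)" "1 < k" "k < d"
    and gcd1: "gcd k (Gcd (X (\<not> s))) = 1" and L3: "m div d \<ge> 3"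
  shows "hamiltonian V adj"
proof -
  have k: "k dvd d" "k > 0" using Y by auto
  obtain \<alpha> where \<alpha>: "transversal_line m (X s) d k \<alpha>"
    using transversal_line_exists[OF sym_step finite_subset[OF Y(1) finite_X] Y(1) d_pos] Y(2) by blast
  obtain \<beta> where \<beta>: "transversal_line m (X (\<not> s)) k 1 \<beta>"
    using transversal_line_exists[OF sym_step finite_X order_refl k(2)] gcd1 by metis
  define n where "n = d div k"
  have len: "length \<alpha> = n" "length \<beta> = k"
    using transversal_line_length[OF \<alpha> k(1) d_pos] transversal_line_length[OF \<beta> _ k(2)] unfolding n_def by auto
  have nk: "n * k = d" unfolding n_def using k by simp
  have "n \<noteq> 0" using nk d_pos by (intro notI) simp
  moreover have "n \<noteq> 1" using nk Y(4) by auto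
  ultimately have n2: "n \<ge> 2" by simp
  \<comment> \<open>The cycle is rotated to start on side s, so that the even positions, linked in
    the direction of \<open>\<alpha>\<close>, are those of side s.\<close>
  have s0: "(s, 0) \<in> set C0" using C0(2) m3 by (simp add: K_iff)
  obtain M where M: "closed_walk hadj ((s, 0) # M)" "set ((s, 0) # M) = set C0"
    using closed_walk_from[OF C0(1) s0] by metis
  define C where "C = (s, 0) # M"
  have C: "closed_walk hadj C" "set C = K" "C ! 0 = (s, 0)" "C \<noteq> []" "distinct C"
    using M C0(2) unfolding C_def closed_walk_def by auto
  define L where "L = length C"
  have L: "L = 2 * (m div d)" using distinct_card[OF C(5)] C(2) card_K unfolding L_def by simp
  have L6: "L \<ge> 6" using L L3 by simp
  have side: "fst (C ! i) = s \<longleftrightarrow> even i" if "i < L" for i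
    using closed_walk_parity[OF C(1), of "\<lambda>v. fst v = s" i] that hadj_side C(3) unfolding L_def by auto
  have CV: "C ! i \<in> V" if "i < L" for i
    using that C(2) nth_mem unfolding L_def K_def by blast
  define D where "D = {..<n} \<times> {..<k}"
  define c where "c = (\<lambda>(a, b). \<alpha> ! a + \<beta> ! b)"
  have \<alpha>k: "\<alpha> ! a mod k = 0" if "a < n" for a
  proof -
    have "\<alpha> ! a mod d \<in> {i. i < d \<and> k dvd i}"
      using \<alpha> that len(1) unfolding transversal_line_def by (metis imageI nth_mem)
    then show ?thesis using k(1) by (auto simp: dvd_mod_iff)
  qed
  \<comment> \<open>Modulo k the contribution of \<open>\<alpha>\<close> vanishes, so b is recovered
    first and then a.\<close>
  have injc: "inj_on (\<lambda>i. c i mod d) D"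
  proof (rule inj_onI)
    fix p q assume pq: "p \<in> D" "q \<in> D" "c p mod d = c q mod d"
    obtain a b a' b' where e: "p = (a, b)" "q = (a', b')" by (metis surj_pair)
    have ab: "a < n" "b < k" "a' < n" "b' < k" using pq e unfolding D_def by auto
    have eq: "(\<alpha> ! a + \<beta> ! b) mod d = (\<alpha> ! a' + \<beta> ! b') mod d" using pq e unfolding c_def by simp
    then have "(\<alpha> ! a + \<beta> ! b) mod k = (\<alpha> ! a' + \<beta> ! b') mod k" using k(1) by (metis mod_mod_cancel)
    then have "\<beta> ! b mod k = \<beta> ! b' mod k"
      using \<alpha>k[OF ab(1)] \<alpha>k[OF ab(3)] by (metis add_0 mod_add_left_eq)
    then have b: "b = b'" using inj_onD[OF inj_on_line[OF \<beta> _ k(2)], of b b'] ab by simp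
    then have "\<alpha> ! a mod d = \<alpha> ! a' mod d" using eq mod_add_right_cancel_nat by metis
    then have "a = a'" using inj_onD[OF inj_on_line[OF \<alpha> k(1) d_pos], of a a'] ab unfolding n_def by simp
    then show "p = q" using b e by simp
  qed
  have cardD: "card D = d" "finite D" unfolding D_def using nk by (auto simp: card_cartesian_product)
  note tile = tiling[OF cardD(2,1) injc]
  define \<phi> where "\<phi> = (\<lambda>(p, i). shift (c p) (C ! i))"
  have injC: "inj_on (nth C) {..<L}" by (rule inj_on_nth) (use C(5) L_def in auto)
  have imC: "nth C ` {..<L} = K" using C(2) unfolding L_def by (auto simp: set_conv_nth)
  have "inj_on \<phi> (D \<times> {..<L})"
  proof (rule inj_onI)
    fix x y assume xy: "x \<in> D \<times> {..<L}" "y \<in> D \<times> {..<L}" "\<phi> x = \<phi> y"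
    obtain p i q j where e: "x = (p, i)" "y = (q, j)" by (metis surj_pair)
    have m: "p \<in> D" "q \<in> D" "i < L" "j < L" using xy e by auto
    then have "(p, C ! i) \<in> D \<times> K" "(q, C ! j) \<in> D \<times> K" using imC by auto
    moreover have "(\<lambda>(i, v). shift (c i) v) (p, C ! i) = (\<lambda>(i, v). shift (c i) v) (q, C ! j)"
      using xy(3) unfolding e \<phi>_def by simp
    ultimately have "(p, C ! i) = (q, C ! j)" using inj_onD[OF tile(1)] by metis
    then show "x = y" using inj_onD[OF injC] m e by auto
  qed
  moreover have "\<phi> ` (D \<times> {..<L}) = V"
  proof -
    have "\<phi> ` (D \<times> {..<L}) = (\<lambda>(i, v). shift (c i) v) ` (map_prod id (nth C) ` (D \<times> {..<L}))"
    proof -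
      have "\<phi> = (\<lambda>(i, v). shift (c i) v) \<circ> map_prod id (nth C)" unfolding \<phi>_def by (simp add: fun_eq_iff)
      then show ?thesis by (simp add: image_comp)
    qed
    also have "map_prod id (nth C) ` (D \<times> {..<L}) = D \<times> K"
      using imC by (simp add: map_prod_surj_on)
    finally show ?thesis using tile(2) by simp
  qed
  moreover have "card (D \<times> {..<L}) \<ge> 3"
  proof -
    have "1 * 6 \<le> card D * L" using cardD d_pos L6 by (intro mult_le_mono) auto
    then show ?thesis by (simp add: card_cartesian_product)
  qed
  moreover obtain E where E: "ham_cycle (D \<times> {..<L}) E" "E \<subseteq> long_grid_edges L"
    using ham_cycle_long_grid[OF toured_grid[OF n2, of k] _ L6] Y(3) unfolding D_def by auto
  have edge: "adj (\<phi> x) (\<phi> y)" if "{x, y} \<in> E" for x y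
  proof -
    have sub: "x \<in> D \<times> {..<L}" "y \<in> D \<times> {..<L}" using ham_cycle_edges[OF E(1) that] by auto
    have pq: ?thesis if "adj (\<phi> p) (\<phi> q)" "{x, y} = {p, q}" for p q
      using that sympD[OF sym_adj, of "\<phi> p" "\<phi> q"] by (auto simp: doubleton_eq_iff)
    have "{x, y} \<in> long_grid_edges L" using that E(2) by blast
    then consider p i where "{x, y} = {(p, i), (p, Suc i mod L)}" "i < L"
      | a b i where "{x, y} = {((a, b), i), ((Suc a, b), i)}" "even i" "i < L"
      | a b i where "{x, y} = {((a, b), i), ((a, Suc b), i)}" "odd i" "i < L"
      unfolding long_grid_edges_def by (elim UnE CollectE exE conjE) simp_all
    then show ?thesis
    proof cases
      case 1
      have "hadj (C ! i) (C ! (Suc i mod L))"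
      proof (cases "Suc i = L")
        case True
        then have "i = length C - 1" "Suc i mod L = 0" unfolding L_def by simp_all
        then have "last C = C ! i" "hd C = C ! (Suc i mod L)" using C(4)
          by (simp_all add: last_conv_nth hd_conv_nth)
        then show ?thesis using C(1) unfolding closed_walk_def by simp
      next
        case False
        then have "Suc i < length C" using 1 unfolding L_def by simp
        then show ?thesis using C(1) unfolding closed_walk_def L_def by (simp add: successively_conv_nth)
      qed
      then show ?thesis using pq[OF _ 1(1)] shift_adj hadj_adj unfolding \<phi>_def by simp
    next
      case 2
      have "((a, b), i) \<in> D \<times> {..<L}" "((Suc a, b), i) \<in> D \<times> {..<L}"
        using sub 2(1) by (auto simp: doubleton_eq_iff)
      then have "step m (X s) (\<alpha> ! a) (\<alpha> ! Suc a)" using step_line[OF \<alpha>] len unfolding D_def by auto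
      then have "step m (X s) (\<alpha> ! a + \<beta> ! b) (\<alpha> ! Suc a + \<beta> ! b)" by (rule step_shift)
      then have "adj (\<phi> ((a, b), i)) (\<phi> ((Suc a, b), i))"
        using shift_link[OF CV[OF 2(3)]] side[OF 2(3)] 2(2) unfolding \<phi>_def c_def by simp
      then show ?thesis using pq 2(1) by blast
    next
      case 3
      have "((a, b), i) \<in> D \<times> {..<L}" "((a, Suc b), i) \<in> D \<times> {..<L}"
        using sub 3(1) by (auto simp: doubleton_eq_iff)
      then have "step m (X (\<not> s)) (\<beta> ! b) (\<beta> ! Suc b)" using step_line[OF \<beta>] len unfolding D_def by auto
      then have "step m (X (\<not> s)) (\<beta> ! b + \<alpha> ! a) (\<beta> ! Suc b + \<alpha> ! a)" by (rule step_shift)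
      moreover have "fst (C ! i) = (\<not> s)" using side[OF 3(3)] 3(2) by auto
      ultimately have "adj (\<phi> ((a, b), i)) (\<phi> ((a, Suc b), i))"
        using shift_link[OF CV[OF 3(3)]] unfolding \<phi>_def c_def by (simp add: add.commute)
      then show ?thesis using pq 3(1) by blast
    qed
  qed
  ultimately show ?thesis using hamiltonian_of_ham_cycle[OF E(1), of \<phi> adj] by metis
qed

section \<open>The case distinction\<close>

lemma X_symmetric: "odd (card (X s)) \<longleftrightarrow> (\<exists>h\<in>X s. 2 * h = m)"
  by (rule card_symmetric_parity[OF X_props(1)]) (use X_props(2) in auto)

text \<open>Every edge changes the index by a multiple of the gcd in question, so divisibility by it
  is constant along walks. As \<open>(False, 0)\<close> and \<open>(False, 1)\<close> are connected,
  it divides 1.\<close>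

lemma gcd_X_one:
  assumes "graph_connected V (bic_adj m R S T)"
  shows "gcd d (Gcd (X True \<union> X False)) = 1"
proof -
  define e where "e = gcd d (Gcd (X True \<union> X False))"
  have e: "e dvd d" "e dvd m" "\<And>s x. x \<in> X s \<Longrightarrow> e dvd x" "\<And>x. x \<in> S \<Longrightarrow> e dvd x"
  proof -
    show 1: "e dvd d" unfolding e_def by simp
    show "e dvd m" using 1 d_dvd_m dvd_trans by blast
    show "e dvd x" if "x \<in> S" for x using 1 d_dvd_S[OF that] dvd_trans by blast
    have "e dvd Gcd (X True \<union> X False)" unfolding e_def by simp
    then show "e dvd x" if "x \<in> X s" for s x using that by (cases s) (auto simp: dvd_Gcd_iff)
  qed
  have inv: "e dvd snd u \<longleftrightarrow> e dvd snd v" if h: "adj u v" for u v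
  proof -
    obtain s i s' j where uv: "u = (s, i)" "v = (s', j)" by (metis surj_pair)
    have *: "e dvd (i + x) mod m \<longleftrightarrow> e dvd i" if "e dvd x" for i x
      using that e(2) by (simp add: dvd_mod_iff dvd_add_left_iff)
    show ?thesis
    proof (cases "s = s'")
      case True
      have "adj (s, i) (s, j)" using h unfolding uv True .
      then obtain x where "x \<in> X s" "j = (i + x) mod m" unfolding adj_same_iff by blast
      then show ?thesis using * e(3) unfolding uv by simp
    next
      case False
      then have "hadj u v" using h uv unfolding adj_def hadj_def haar_adj_def
        by (cases s; cases s') auto
      then obtain x where "x \<in> S" "j = (i + x) mod m \<or> i = (j + x) mod m"
        using False unfolding uv by (cases s; cases s') (auto simp: hadj_iff)
      then show ?thesis using * e(4) unfolding uv by auto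
    qed
  qed
  have "(\<lambda>a b. a \<in> V \<and> b \<in> V \<and> bic_adj m R S T a b) = adj" unfolding adj_def by (simp add: fun_eq_iff)
  then have "adj\<^sup>*\<^sup>* (False, 0) (False, 1)"
    using assms m3 unfolding graph_connected_def by (simp add: V_iff)
  then have "e dvd snd (False, 0) \<longleftrightarrow> e dvd snd (False, 1::nat)"
    by (induction rule: rtranclp_induct) (use inv in auto)
  then show ?thesis unfolding e_def[symmetric] by simp
qed

text \<open>The number \<open>k s\<close> describes the subgroup generated by \<open>X s\<close>
  modulo d. If it is proper and nontrivial, a grid arises. If it is trivial, \<open>X s\<close>
  consists of chords and, by connectivity, the other set generates everything. If both sets generate
  everything, the element from \<open>nc\<close> decides.\<close>

lemma hamiltonian_bicirculant:
  assumes card: "card R = card T" and S3: "card S \<ge> 3"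
    and conn: "graph_connected V (bic_adj m R S T)"
    and C: "closed_walk hadj C" "set C = K"
    and nc: "d > 1 \<Longrightarrow> \<exists>s. \<exists>x\<in>X s. gcd x d > 1"
  shows "hamiltonian V adj"
proof -
  have md: "m div d \<ge> 3"
  proof -
    have "S \<subseteq> {i. i < m \<and> d dvd i}" using subsets d_dvd_S by auto
    then have "card S \<le> card {i. i < m \<and> d dvd i}" by (intro card_mono) auto
    then show ?thesis using card_multiples[OF d_dvd_m] m3 S3 by simp
  qed
  then have K3: "card K \<ge> 3" using card_K by simp
  define k where "k s = gcd d (Gcd (X s))" for s
  have kd: "k s dvd d" "k s > 0" for s using d_pos unfolding k_def by auto
  have coprime: "gcd (k s) (Gcd (X (\<not> s))) = 1" for s
  proof -
    have "gcd d (gcd (Gcd (X True)) (Gcd (X False))) = 1"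
      (is "?g = 1")
    proof -
      have "?g dvd Gcd (X t)" for t by (cases t) (auto intro: dvd_trans)
      then have "?g dvd x" if "x \<in> X t" for x t using that by (meson Gcd_dvd dvd_trans)
      then have "?g dvd Gcd (X True \<union> X False)" by (intro Gcd_greatest) blast
      then have "?g dvd gcd d (Gcd (X True \<union> X False))" by simp
      then show ?thesis using gcd_X_one[OF conn] by simp
    qed
    then show ?thesis unfolding k_def by (cases s) (simp_all add: gcd.assoc gcd.commute gcd.left_commute)
  qed
  have cardX: "card (X s) = card (X (\<not> s))" for s using card unfolding X_def by auto
  have line: "\<exists>cs. transversal_line m (X s) d 1 cs" if "k s = 1" for s
    using transversal_line_exists[OF sym_step finite_X order_refl d_pos, of s] that unfolding k_def by metis
  show ?thesis
  proof (cases "d = 1")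
    case True
    then have "K = V" unfolding K_def by auto
    have "C \<noteq> []" "length C \<ge> 3" using K3 C distinct_card[of C] unfolding closed_walk_def by auto
    moreover have "successively adj C" "adj (last C) (hd C)"
      using C(1) hadj_adj unfolding closed_walk_def by (auto intro: successively_mono)
    ultimately show ?thesis using C hamiltonianI[of C V adj] unfolding closed_walk_def \<open>K = V\<close> by blast
  next
    case False
    then have d2: "d \<ge> 2" using d_pos by simp
    consider s where "k s \<noteq> 1" "k s \<noteq> d" | s where "k s = d" | "\<And>s. k s = 1" by blast
    then show ?thesis
    proof cases
      case 1
      moreover have "k s \<le> d" using dvd_imp_le[OF kd(1) d_pos] .
      ultimately have "1 < k s" "k s < d" using kd(2)[of s] by auto
      then show ?thesis by (rule hamiltonian_by_grid[OF C order_refl k_def _ _ coprime md])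
    next
      case 2
      have dX: "d dvd x" if "x \<in> X s" for x using 2 that gcd_Gcd_dvd unfolding k_def by blast
      have k1: "k (\<not> s) = 1"
        using coprime[of s] 2 k_def[of "\<not> s"] by metis
      obtain y where y: "y \<in> X (\<not> s)" "\<not> d dvd y"
        using k1 d2 gcd_Gcd_dvd[of d "X (\<not> s)"] unfolding k_def by auto
      \<comment> \<open>If \<open>X s\<close> were just {m/2}, the other set would also have one
        element, by symmetry again m/2; but y is not a multiple of d.\<close>
      have "\<exists>x\<in>X s. 2 * x \<noteq> m"
      proof (rule ccontr)
        assume "\<not> (\<exists>x\<in>X s. 2 * x \<noteq> m)"
        then have h: "\<And>x. x \<in> X s \<Longrightarrow> 2 * x = m" by blast
        have "card (X (\<not> s)) > 0" using y finite_X card_gt_0_iff by blast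
        then have "X s \<noteq> {}" using cardX[of s] by auto
        then obtain x where x: "x \<in> X s" by blast
        have "w = x" if "w \<in> X s" for w using h[OF that] h[OF x] by simp
        then have "X s = {x}" using x by blast
        then have "card (X (\<not> s)) = 1" using cardX[of s] by simp
        then obtain z where "X (\<not> s) = {z}" by (auto simp: card_1_singleton_iff)
        then have "X (\<not> s) = {y}" using y by auto
        moreover have "m - y \<in> X (\<not> s)" "y < m" using X_props(2)[OF y(1)] subsetD[OF X_props(1) y(1)] by auto
        ultimately have "2 * y = m" by auto
        then have "y = x" using h[OF x] by simp
        then show False using dX[OF x] y by simp
      qed
      then obtain x where x: "x \<in> X s" "2 * x \<noteq> m" by blast
      obtain cs where "transversal_line m (X (\<not> s)) d 1 cs" using line[OF k1] by blast
      then show ?thesis using hamiltonian_by_chords[OF C x(1) dX[OF x(1)] x(2) _ d2 K3] by blast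
    next
      case 3
      obtain s x where x: "x \<in> X s" "gcd x d > 1" using nc d2 by auto
      show ?thesis
      proof (cases "d dvd x")
        case False
        \<comment> \<open>The element x alone generates a proper nontrivial subgroup; the other set
          generates everything modulo d and so also the quotient.\<close>
        define g where "g = gcd d (Gcd {x})"
        have g: "g = gcd x d" unfolding g_def by (simp add: gcd.commute)
        have "g \<noteq> d" using False unfolding g by (metis gcd_dvd1)
        moreover have "g \<le> d" using d_pos unfolding g by (intro dvd_imp_le) auto
        moreover have "g dvd d" unfolding g by simp
        then have "gcd g (Gcd (X (\<not> s))) dvd k (\<not> s)" unfolding k_def by (meson gcd_dvd1 gcd_dvd2 gcd_greatest dvd_trans)
        then have "gcd g (Gcd (X (\<not> s))) = 1" using 3[of "\<not> s"] by simp
        ultimately show ?thesis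
          using hamiltonian_by_grid[OF C _ g_def _ _ _ md] x unfolding g by auto
      next
        case True
        show ?thesis
        proof (cases "2 * x = m")
          case False
          obtain cs where "transversal_line m (X (\<not> s)) d 1 cs" using line[OF 3] by blast
          then show ?thesis using hamiltonian_by_chords[OF C x(1) True False _ d2 K3] by blast
        next
          case half: True
          \<comment> \<open>The parity of the common cardinality forces m/2 into the other set as
            well, so there are chords on both sides.\<close>
          have "odd (card (X s))" using X_symmetric x half by blast
          then have "odd (card (X (\<not> s)))" using cardX[of s] by simp
          then obtain h where "h \<in> X (\<not> s)" "2 * h = m" using X_symmetric by blast
          moreover from this have "h = x" using half by simp
          ultimately have "x \<in> X (\<not> s)" by simp
          then have "x \<in> X t" for t using x(1) by (cases "t = s") auto
          then show ?thesis using hamiltonian_by_halves[OF C _ True half line[OF 3] d2 md] by blast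
        qed
      qed
    qed
  qed
qed

end

theorem theorem1p5:
  fixes m :: nat and R S T :: "nat set"
  assumes "m \<ge> 3"
    and "R \<subseteq> {0..<m}" and "S \<subseteq> {0..<m}" and "T \<subseteq> {0..<m}"
    and "\<forall>j\<in>R. (m - j) mod m \<in> R" and "\<forall>j\<in>T. (m - j) mod m \<in> T"
    and "0 \<notin> R" and "0 \<notin> T" and "0 \<in> S"
    and "card R = card T"
    and "card S \<ge> 3"
    and "graph_connected (bic_verts m) (bic_adj m R S T)"
    and "\<forall>x\<in>bic_verts m. hamiltonian (component_of (bic_verts m) (haar_adj m S) x) (haar_adj m S)"
    and "gcd_mS m S > 1 \<Longrightarrow> (\<exists>x\<in>R \<union> T. gcd x (gcd_mS m S) > 1)"
  shows "hamiltonian (bic_verts m) (bic_adj m R S T)"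
proof -
  have sub: "A \<subseteq> {0<..<m}" if "A \<subseteq> {0..<m}" "0 \<notin> A" for A :: "nat set"
    using that by (force simp: subset_iff intro: Nat.gr0I)
  interpret bicirculant m R S T
    by unfold_locales (use assms sub in auto)
  have "(False, 0) \<in> bic_verts m" using \<open>m \<ge> 3\<close> unfolding bic_verts_def by simp
  then have "hamiltonian (component_of (bic_verts m) (haar_adj m S) (False, 0)) (haar_adj m S)"
    using assms(13) by blast
  then obtain C where C: "closed_walk hadj C" "set C = K" by (rule haar_cycle)
  have "\<exists>s. \<exists>x\<in>X s. gcd x d > 1" if d1: "d > 1"
  proof -
    obtain x where x: "x \<in> R \<union> T" "gcd x d > 1" using assms(14)[OF d1[unfolded d_def]] unfolding d_def by blast
    then have "x \<in> X True \<or> x \<in> X False" unfolding X_def by auto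
    then show ?thesis using x(2) by blast
  qed
  then have "hamiltonian V adj"
    using hamiltonian_bicirculant[OF assms(10,11) _ C] assms(12) unfolding V_def by blast
  then show ?thesis by (rule hamiltonian_adj)
qed

end
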